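(* Let $S$ be a finite alphabet and let $X \subset S^{\mathbb{N}}$ be a recursive quasiminimal $\mathbb{N}$-subshift. Then $X$ is decidable.
   Context: $\mathbb{N}=\{0,1,2,\dots\}$. For a finite alphabet $S$, give $S^{\mathbb{N}}$ the product topology and the shift $\sigma(x)_i = x_{i+1}$. An $\mathbb{N}$-subshift is a closed set $X \subset S^{\mathbb{N}}$ with $\sigma(X) \subset X$ (surjectivity of $\sigma$ on $X$ is not required). A subshift of $X$ is an $\mathbb{N}$-subshift $Y\subset X$. $X$ is quasiminimal if it has finitely many proper subshifts. $X$ is recursive if its language $\mathcal{L}(X)$ (the set of finite words occurring as contiguous subwords of points of $X$) is recursive. $X$ is decidable if its model-checking problem for Muller automata is decidable: given a Muller automaton (a finite automaton reading infinite words, accepting according to whether the set of states visited infinitely often belongs to a prescribed family of sets of states) describing a language $Y \subset S^{\mathbb{N}}$ of infinite words, decide whether $X \cap Y \neq \emptyset$. Here $X$ is fixed; only the automaton is the input. *)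

theory Defs
  imports
    "HOL-Analysis.Function_Topology"
    "HOL-Library.Countable_Set"
    "HOL-Library.Nat_Bijection"
begin

section \<open>Recursive functions and decision problems\<close>

text \<open>
  \<open>recursive_fun n f\<close> says that \<open>f\<close>, viewed as an \<open>n\<close>-ary function on the naturals, is
  (total, general) recursive; only the values of \<open>f\<close> on lists of length \<open>n\<close> are meaningful.
  Minimization is applied to regular functions only, so no partial functions arise; by
  Kleene's normal form theorem this yields exactly the total Turing-computable functions.
\<close>

inductive recursive_fun :: "nat \<Rightarrow> (nat list \<Rightarrow> nat) \<Rightarrow> bool" where
  rf_zero: "recursive_fun n (\<lambda>_. 0)"
| rf_succ: "recursive_fun 1 (\<lambda>xs. Suc (xs ! 0))"
| rf_proj: "i < n \<Longrightarrow> recursive_fun n (\<lambda>xs. xs ! i)"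
| rf_comp: "recursive_fun (length gs) f \<Longrightarrow> \<forall>g\<in>set gs. recursive_fun n g
    \<Longrightarrow> recursive_fun n (\<lambda>xs. f (map (\<lambda>g. g xs) gs))"
| rf_prim_rec: "recursive_fun n f \<Longrightarrow> recursive_fun (Suc (Suc n)) g
    \<Longrightarrow> recursive_fun (Suc n)
          (\<lambda>xs. rec_nat (f (tl xs)) (\<lambda>k r. g (k # r # tl xs)) (hd xs))"
| rf_mu: "recursive_fun (Suc n) f \<Longrightarrow> \<forall>xs. length xs = n \<longrightarrow> (\<exists>k. f (k # xs) = 0)
    \<Longrightarrow> recursive_fun n (\<lambda>xs. LEAST k. f (k # xs) = 0)"

text \<open>
  The problem with instances \<open>I\<close>, presented to the algorithm through the coding \<open>code\<close>, and
  yes-instances \<open>I \<inter> P\<close>. The behaviour on numbers that code no instance is left open; this is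
  immaterial for the two codings below, whose ranges are recursive.
\<close>

definition decidable_problem :: "('i \<Rightarrow> nat) \<Rightarrow> 'i set \<Rightarrow> 'i set \<Rightarrow> bool" where
  "decidable_problem code I P \<longleftrightarrow>
     (\<exists>f. recursive_fun 1 f \<and> (\<forall>i\<in>I. f [code i] = (if i \<in> P then 1 else 0)))"


section \<open>One-sided subshifts\<close>

definition shift_map :: "(nat \<Rightarrow> 'a) \<Rightarrow> nat \<Rightarrow> 'a" where
  "shift_map x = (\<lambda>i. x (Suc i))"

definition subshift :: "'a set \<Rightarrow> (nat \<Rightarrow> 'a) set \<Rightarrow> bool" where
  "subshift S X \<longleftrightarrow>
     closedin (product_topology (\<lambda>_. discrete_topology S) UNIV) X \<and> shift_map ` X \<subseteq> X"

definition quasiminimal :: "'a set \<Rightarrow> (nat \<Rightarrow> 'a) set \<Rightarrow> bool" where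
  "quasiminimal S X \<longleftrightarrow> finite {Y. subshift S Y \<and> Y \<subset> X}"

definition language :: "(nat \<Rightarrow> 'a) set \<Rightarrow> 'a list set" where
  "language X = {w. \<exists>x\<in>X. \<exists>i n. w = map x [i..<i + n]}"

text \<open>
  For finite \<open>S\<close>, \<open>to_nat_on S\<close> is a bijection from \<open>S\<close> to \<open>{..<card S}\<close> with inverse
  \<open>from_nat_into S\<close>. As \<open>S\<close> is finite, the choice of this numbering of the letters does not
  affect which problems are decidable.
\<close>

definition word_code :: "'a set \<Rightarrow> 'a list \<Rightarrow> nat" where
  "word_code S w = list_encode (map (to_nat_on S) w)"

definition recursive_subshift :: "'a set \<Rightarrow> (nat \<Rightarrow> 'a) set \<Rightarrow> bool" where
  "recursive_subshift S X \<longleftrightarrow> decidable_problem (word_code S) (lists S) (language X)"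


section \<open>Muller automata\<close>

text \<open>
  Muller automata are deterministic and complete. Being inputs of algorithms, they have an
  initial segment \<open>{..<num_states A}\<close> of the naturals as their set of states.
\<close>

record 'a muller =
  num_states :: nat
  initial :: nat
  trans_fun :: "nat \<Rightarrow> 'a \<Rightarrow> nat"
  acc_family :: "nat set set"

definition muller_automaton :: "'a set \<Rightarrow> 'a muller \<Rightarrow> bool" where
  "muller_automaton S A \<longleftrightarrow>
     initial A < num_states A \<and>
     (\<forall>q<num_states A. \<forall>a\<in>S. trans_fun A q a < num_states A) \<and>
     acc_family A \<subseteq> Pow {..<num_states A}"

primrec muller_run :: "'a muller \<Rightarrow> (nat \<Rightarrow> 'a) \<Rightarrow> nat \<Rightarrow> nat" where
  "muller_run A x 0 = initial A"
| "muller_run A x (Suc n) = trans_fun A (muller_run A x n) (x n)"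

definition muller_language :: "'a set \<Rightarrow> 'a muller \<Rightarrow> (nat \<Rightarrow> 'a) set" where
  "muller_language S A =
     {x. (\<forall>i. x i \<in> S) \<and> {q. infinite {n. muller_run A x n = q}} \<in> acc_family A}"

text \<open>
  The transition function is coded by its table, with one row per state and one column per
  letter; the acceptance family by iterating the binary coding of finite sets of naturals.
\<close>

definition muller_code :: "'a set \<Rightarrow> 'a muller \<Rightarrow> nat" where
  "muller_code S A = list_encode
     [num_states A,
      initial A,
      list_encode
        (map (\<lambda>q. list_encode (map (\<lambda>j. trans_fun A q (from_nat_into S j)) [0..<card S]))
          [0..<num_states A]),
      set_encode (set_encode ` acc_family A)]"

definition decidable_subshift :: "'a set \<Rightarrow> (nat \<Rightarrow> 'a) set \<Rightarrow> bool" where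
  "decidable_subshift S X \<longleftrightarrow>
     decidable_problem (muller_code S) {A. muller_automaton S A}
       {A. X \<inter> muller_language S A \<noteq> {}}"

end

theory Submission
  imports Defs
begin

text \<open>
  The proof finds, for every automaton, a positive number \<open>R\<close> with the following property: on every point of
  \<open>X\<close> and from every state, the set of states visited during \<open>R\<close> consecutive steps is the same for
  all windows that start at time \<open>R\<close> or later. The states visited infinitely often are then
  exactly those seen from time \<open>R\<close> to time \<open>2 R - 1\<close>, so acceptance depends only on the prefix of length
  \<open>2 R\<close>, and the prefixes of points of \<open>X\<close> are the words of its language. Moreover the property
  of \<open>R\<close> follows from its instance \<open>window q x R R = window q x (Suc R) R\<close> for all \<open>x\<close> and \<open>q\<close>, because
  \<open>X\<close> is shift invariant. This instance is a condition on the words of length \<open>2 R + 1\<close> in the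
  language, so that \<open>R\<close> can be recognised, and hence found, by an algorithm.

  Such an \<open>R\<close> exists for two reasons. The first concerns \<open>X\<close> alone. The orbit closure of a point
  and its set of factors determine each other, so by quasiminimality only a finite number \<open>N\<close> of sets of
  factors occur in \<open>X\<close> (\<open>quasiminimal_finite_factors\<close>). The factors of the successive
  shifts of a point decrease, and they stay constant once two consecutive sets agree; so they
  are constant from time \<open>N\<close> on (\<open>factors_eventually_stable\<close>). If some factor \<open>u\<close> of such a
  tail returned with unbounded gaps, then a limit of shifts of the point that start \<open>N\<close> letters before
  longer and longer gaps would be a point of \<open>X\<close> with an occurrence of \<open>u\<close> at position \<open>N\<close> and none
  later, against the constancy from time \<open>N\<close> on. So the \<open>N\<close>-th shift of every point of \<open>X\<close>
  is uniformly recurrent (\<open>uniformly_recurrent_tail\<close>).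

  The second reason concerns a uniformly recurrent sequence and an automaton. Take a factor \<open>w\<close>
  whose action on the states has an image \<open>B\<close> of least size, and then \<open>u\<close> such that \<open>w @ u\<close> is a factor
  and the sets of states visited while reading \<open>u\<close> from the elements of \<open>B\<close> have the largest
  possible total size. In an occurrence of \<open>w @ u\<close>, reading \<open>u\<close> from \<open>p \<in> B\<close> already visits every
  state that will ever be visited from there. These sets can only shrink from one
  occurrence of \<open>w @ u\<close> to the next; but between two occurrences \<open>B\<close> is permuted, so that the total size is
  unchanged and each set is preserved. As \<open>w @ u\<close> returns with bounded gaps, every long window sees the
  whole set (\<open>windows_stabilize_uniformly_recurrent\<close>). The bound depends on the factors only, and there are
  finitely many sets of factors, so it can be chosen uniformly on \<open>X\<close> (\<open>windows_stabilize\<close>).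

  The computability of the resulting search is established by closure properties of computable functions.
\<close>

section \<open>Computable functions of an environment\<close>

text \<open>
  Computability for functions of an environment, an infinite list of numbers of which only a
  finite initial segment matters. As no arity is recorded, a term is shown computable by
  following its syntax: variables are \<open>\<lambda>e. e i\<close>, and a binder shifts the environment by one or two
  places as in de Bruijn notation.
\<close>

definition computable :: "((nat \<Rightarrow> nat) \<Rightarrow> nat) \<Rightarrow> bool" where
  "computable f \<longleftrightarrow> (\<exists>n g. recursive_fun n g \<and> (\<forall>e. f e = g (map e [0..<n])))"

definition computable_pred :: "((nat \<Rightarrow> nat) \<Rightarrow> bool) \<Rightarrow> bool" where
  "computable_pred P \<longleftrightarrow> computable (\<lambda>e. of_bool (P e))"

named_theorems computable_intros

text \<open>
  Functions of different arities can be composed once their arities have been raised to a common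
  value.
\<close>

lemma computable_arity:
  assumes "computable f"
  shows "\<exists>n. \<forall>m\<ge>n. \<exists>g. recursive_fun m g \<and> (\<forall>e. f e = g (map e [0..<m]))"
proof -
  obtain n g where g: "recursive_fun n g" "\<And>e. f e = g (map e [0..<n])"
    using assms unfolding computable_def by blast
  have "\<exists>h. recursive_fun m h \<and> (\<forall>e. f e = h (map e [0..<m]))" if "m \<ge> n" for m
  proof -
    let ?ps = "map (\<lambda>i xs. xs ! i) [0..<n] :: (nat list \<Rightarrow> nat) list"
    have "recursive_fun m (\<lambda>xs. g (map (\<lambda>p. p xs) ?ps))"
      using g(1) that by (intro rf_comp) (auto intro: rf_proj)
    moreover have "map (\<lambda>p. p (map e [0..<m])) ?ps = map e [0..<n]" for e :: "nat \<Rightarrow> nat"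
      using that by (auto simp: comp_def)
    ultimately show ?thesis
      using g(2) by (intro exI[of _ "\<lambda>xs. g (map (\<lambda>p. p xs) ?ps)"]) (simp only: simp_thms)
  qed
  thus ?thesis by blast
qed

lemma computable_var [computable_intros]: "computable (\<lambda>e. e i)"
proof -
  have "recursive_fun (Suc i) (\<lambda>xs. xs ! i)" by (rule rf_proj) simp
  moreover have "e i = map e [0..<Suc i] ! i" for e :: "nat \<Rightarrow> nat" by (simp del: upt_Suc)
  ultimately show ?thesis unfolding computable_def by blast
qed

lemma computable_subst:
  assumes "computable f" and s: "\<And>i. computable (\<lambda>e. s e i)"
  shows "computable (\<lambda>e. f (s e))"
proof -
  obtain n g where g: "recursive_fun n g" "\<And>e. f e = g (map e [0..<n])"
    using assms(1) unfolding computable_def by blast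
  obtain N where N: "\<And>i m. m \<ge> N i \<Longrightarrow> \<exists>h. recursive_fun m h \<and> (\<forall>e. s e i = h (map e [0..<m]))"
    using computable_arity[OF s] by meson
  define m where "m = Max (insert 0 (N ` {..<n}))"
  have "N i \<le> m" if "i < n" for i
    unfolding m_def using that by (intro Max_ge) auto
  hence "\<forall>i\<in>{..<n}. \<exists>h. recursive_fun m h \<and> (\<forall>e. s e i = h (map e [0..<m]))"
    using N by blast
  from bchoice[OF this] obtain h where h: "\<And>i. i < n \<Longrightarrow> recursive_fun m (h i)"
    "\<And>i e. i < n \<Longrightarrow> s e i = h i (map e [0..<m])"
    by blast
  have "recursive_fun m (\<lambda>xs. g (map (\<lambda>p. p xs) (map h [0..<n])))"
    using g(1) h(1) by (intro rf_comp) auto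
  moreover have "f (s e) = g (map (\<lambda>p. p (map e [0..<m])) (map h [0..<n]))" for e
    unfolding g(2) using h(2) by (auto intro!: arg_cong[where f = g])
  ultimately show ?thesis unfolding computable_def
    by (intro exI[of _ m] exI[of _ "\<lambda>xs. g (map (\<lambda>p. p xs) (map h [0..<n]))"]) blast
qed

lemma computable_comp1:
  assumes "computable (\<lambda>e. h (e 0))" "computable a"
  shows "computable (\<lambda>e. h (a e))"
  using computable_subst[OF assms(1), of "\<lambda>e _. a e"] assms(2) by simp

lemma computable_comp2:
  assumes "computable (\<lambda>e. h (e 0) (e 1))" "computable a" "computable b"
  shows "computable (\<lambda>e. h (a e) (b e))"
proof -
  have "computable (\<lambda>e. if i = 0 then a e else b e)" for i :: nat
    using assms(2,3) by (cases "i = 0") auto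
  from computable_subst[where s = "\<lambda>e i. if i = 0 then a e else b e", OF assms(1) this]
  show ?thesis by simp
qed

lemma computable_Suc [computable_intros]:
  assumes "computable a"
  shows "computable (\<lambda>e. Suc (a e))"
proof -
  have "computable (\<lambda>e. Suc (e 0))"
    unfolding computable_def by (intro exI[of _ 1] exI[of _ "\<lambda>xs. Suc (xs ! 0)"]) (simp add: rf_succ[simplified])
  from computable_comp1[OF this assms] show ?thesis .
qed

lemma computable_const [computable_intros]: "computable (\<lambda>_. c)"
proof (induction c)
  case 0
  show ?case unfolding computable_def using rf_zero[of 0] by blast
qed (rule computable_Suc)

text \<open>
  The body of the recursion sees the counter and the previous value as variables 0 and 1; the
  variables of the surrounding environment move up by two.
\<close>

lemma computable_rec_nat [computable_intros]:
  assumes "computable a" and "computable (\<lambda>e. g (e 0) (e 1) (\<lambda>i. e (Suc (Suc i))))"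
    and "computable b"
  shows "computable (\<lambda>e. rec_nat (a e) (\<lambda>k r. g k r e) (b e))"
proof -
  obtain n where n: "\<And>m. m \<ge> n \<Longrightarrow> \<exists>h. recursive_fun m h \<and> (\<forall>e. a e = h (map e [0..<m]))"
    using computable_arity[OF assms(1)] by blast
  obtain n' where n': "\<And>m. m \<ge> n' \<Longrightarrow> \<exists>h. recursive_fun m h \<and>
      (\<forall>e. g (e 0) (e 1) (\<lambda>i. e (Suc (Suc i))) = h (map e [0..<m]))"
    using computable_arity[OF assms(2)] by blast
  define m where "m = max n n'"
  obtain h where h: "recursive_fun m h" "\<And>e. a e = h (map e [0..<m])"
    using n[of m] unfolding m_def by auto
  obtain h' where h': "recursive_fun (Suc (Suc m)) h'"
    "\<And>e. g (e 0) (e 1) (\<lambda>i. e (Suc (Suc i))) = h' (map e [0..<Suc (Suc m)])"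
    using n'[of "Suc (Suc m)"] unfolding m_def by (metis le_SucI max.cobounded2)
  have h'2: "g k r e = h' (k # r # map e [0..<m])" for k r e
    using h'(2)[of "case_nat k (case_nat r e)"] by (simp add: map_upt_Suc del: upt_Suc)
  have "recursive_fun (Suc m) (\<lambda>xs. rec_nat (h (tl xs)) (\<lambda>k r. h' (k # r # tl xs)) (hd xs))"
    using h(1) h'(1) by (rule rf_prim_rec)
  moreover have "rec_nat (a (\<lambda>i. e (Suc i))) (\<lambda>k r. g k r (\<lambda>i. e (Suc i))) (e 0)
      = (\<lambda>xs. rec_nat (h (tl xs)) (\<lambda>k r. h' (k # r # tl xs)) (hd xs)) (map e [0..<Suc m])" for e
    by (simp add: map_upt_Suc h(2) h'2 del: upt_Suc)
  ultimately have "computable (\<lambda>e. rec_nat (a (\<lambda>i. e (Suc i))) (\<lambda>k r. g k r (\<lambda>i. e (Suc i))) (e 0))"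
    unfolding computable_def by blast
  moreover have "computable (\<lambda>e. case_nat (b e) e i)" for i
    using assms(3) by (cases i) (auto intro: computable_var)
  ultimately have "computable (\<lambda>e. (\<lambda>e. rec_nat (a (\<lambda>i. e (Suc i))) (\<lambda>k r. g k r (\<lambda>i. e (Suc i))) (e 0))
      (case_nat (b e) e))"
    by (rule computable_subst)
  thus ?thesis by simp
qed

lemma computable_add [computable_intros]:
  assumes "computable a" "computable b"
  shows "computable (\<lambda>e. a e + b e)"
proof -
  have "rec_nat x (\<lambda>_ r. Suc r) y = x + y" for x y :: nat by (induction y) auto
  moreover have "computable (\<lambda>e. rec_nat (a e) (\<lambda>_ r. Suc r) (b e))"
    by (intro computable_intros assms)
  ultimately show ?thesis by simp
qed

lemma computable_mult [computable_intros]: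
  assumes "computable a" "computable b"
  shows "computable (\<lambda>e. a e * b e)"
proof -
  have "rec_nat 0 (\<lambda>_ r. r + x) y = x * y" for x y :: nat by (induction y) auto
  moreover have "computable (\<lambda>e. rec_nat 0 (\<lambda>_ r. r + e 0) (e 1))"
    by (intro computable_intros)
  ultimately have "computable (\<lambda>e. e 0 * e 1)" by simp
  from computable_comp2[OF this assms] show ?thesis .
qed

lemma computable_diff [computable_intros]:
  assumes "computable a" "computable b"
  shows "computable (\<lambda>e. a e - b e :: nat)"
proof -
  have pred: "rec_nat 0 (\<lambda>k _. k) x = x - 1" for x :: nat by (cases x) auto
  have "computable (\<lambda>e. rec_nat 0 (\<lambda>k _. k) (e 0))" by (intro computable_intros)
  note pred_comp = computable_comp1[OF this[unfolded pred]]
  have diff: "rec_nat x (\<lambda>_ r. r - 1) y = x - y" for x y :: nat by (induction y) auto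
  have "computable (\<lambda>e. rec_nat (a e) (\<lambda>_ r. r - 1) (b e))"
    by (intro computable_intros pred_comp assms)
  thus ?thesis by (simp only: diff)
qed

lemma computable_of_bool [computable_intros]:
  "computable_pred P \<Longrightarrow> computable (\<lambda>e. of_bool (P e))"
  by (simp add: computable_pred_def)

lemma computable_pred_not [computable_intros]:
  assumes "computable_pred P"
  shows "computable_pred (\<lambda>e. \<not> P e)"
proof -
  have "computable (\<lambda>e. 1 - of_bool (P e))" by (intro computable_intros assms)
  moreover have "1 - of_bool Q = (of_bool (\<not> Q) :: nat)" for Q by simp
  ultimately show ?thesis unfolding computable_pred_def by (simp only:)
qed

lemma computable_pred_conj [computable_intros]:
  assumes "computable_pred P" "computable_pred Q"
  shows "computable_pred (\<lambda>e. P e \<and> Q e)"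
proof -
  have "computable (\<lambda>e. of_bool (P e) * of_bool (Q e))" by (intro computable_intros assms)
  thus ?thesis unfolding computable_pred_def of_bool_conj .
qed

lemma computable_pred_disj [computable_intros]:
  assumes "computable_pred P" "computable_pred Q"
  shows "computable_pred (\<lambda>e. P e \<or> Q e)"
proof -
  have "computable_pred (\<lambda>e. \<not> (\<not> P e \<and> \<not> Q e))" by (intro computable_intros assms)
  thus ?thesis by simp
qed

lemma computable_pred_imp [computable_intros]:
  assumes "computable_pred P" "computable_pred Q"
  shows "computable_pred (\<lambda>e. P e \<longrightarrow> Q e)"
proof -
  have "computable_pred (\<lambda>e. \<not> P e \<or> Q e)" by (intro computable_intros assms)
  thus ?thesis by (simp only: imp_conv_disj)
qed

lemma computable_pred_iff [computable_intros]:
  assumes "computable_pred P" "computable_pred Q"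
  shows "computable_pred (\<lambda>e. P e \<longleftrightarrow> Q e)"
proof -
  have "computable_pred (\<lambda>e. (P e \<longrightarrow> Q e) \<and> (Q e \<longrightarrow> P e))" by (intro computable_intros assms)
  thus ?thesis by (simp only: iff_conv_conj_imp)
qed

lemma computable_pred_le [computable_intros]:
  assumes "computable a" "computable b"
  shows "computable_pred (\<lambda>e. a e \<le> b e)"
proof -
  have "computable (\<lambda>e. 1 - (a e - b e))" by (intro computable_intros assms)
  moreover have "1 - (x - y) = of_bool (x \<le> y)" for x y :: nat by (cases "x \<le> y") auto
  ultimately show ?thesis unfolding computable_pred_def by (simp only:)
qed

lemma computable_pred_less [computable_intros]:
  assumes "computable a" "computable b"
  shows "computable_pred (\<lambda>e. a e < b e)"
  unfolding less_eq_Suc_le by (intro computable_intros assms)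

lemma computable_pred_eq [computable_intros]:
  fixes a b :: "(nat \<Rightarrow> nat) \<Rightarrow> nat"
  assumes "computable a" "computable b"
  shows "computable_pred (\<lambda>e. a e = b e)"
proof -
  have "computable_pred (\<lambda>e. a e \<le> b e \<and> b e \<le> a e)" by (intro computable_intros assms)
  thus ?thesis by (simp only: order_eq_iff)
qed

lemma computable_if [computable_intros]:
  assumes "computable_pred P" "computable a" "computable b"
  shows "computable (\<lambda>e. if P e then a e else b e)"
proof -
  have "computable (\<lambda>e. of_bool (P e) * a e + of_bool (\<not> P e) * b e)"
    by (intro computable_intros assms)
  moreover have "of_bool Q * x + of_bool (\<not> Q) * y = (if Q then x else y)" for Q and x y :: nat
    by simp
  ultimately show ?thesis by (simp only:)
qed

text \<open>
  The bounded quantifier is a disjunction accumulated by primitive recursion.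
\<close>

lemma computable_pred_bex_less [computable_intros]:
  assumes "computable_pred (\<lambda>e. P (e 0) (\<lambda>i. e (Suc i)))" "computable b"
  shows "computable_pred (\<lambda>e. \<exists>k<b e. P k e)"
proof -
  have "computable_pred (\<lambda>e. P (e 0) (\<lambda>i. e (Suc (Suc i))))"
  proof -
    have "computable (\<lambda>e. case_nat (e 0) (\<lambda>i. e (Suc (Suc i))) i)" for i
      by (cases i) (auto intro: computable_var)
    from computable_subst[where s = "\<lambda>e. case_nat (e 0) (\<lambda>i. e (Suc (Suc i)))",
        OF assms(1)[unfolded computable_pred_def] this]
    show ?thesis unfolding computable_pred_def by simp
  qed
  hence "computable (\<lambda>e. rec_nat 0 (\<lambda>k r. if r = 1 \<or> P k e then 1 else 0) (b e))"
    by (intro computable_intros assms)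
  moreover have "rec_nat 0 (\<lambda>k r. if r = 1 \<or> P k e then 1 else 0) m = (of_bool (\<exists>k<m. P k e) :: nat)"
    for e m
    by (induction m) (auto simp: less_Suc_eq)
  ultimately show ?thesis unfolding computable_pred_def by (simp only:)
qed

lemma computable_pred_bex_le [computable_intros]:
  assumes "computable_pred (\<lambda>e. P (e 0) (\<lambda>i. e (Suc i)))" "computable b"
  shows "computable_pred (\<lambda>e. \<exists>k\<le>b e. P k e)"
  unfolding less_Suc_eq_le[symmetric] by (intro computable_intros assms)

lemma computable_pred_ball_less [computable_intros]:
  assumes "computable_pred (\<lambda>e. P (e 0) (\<lambda>i. e (Suc i)))" "computable b"
  shows "computable_pred (\<lambda>e. \<forall>k<b e. P k e)"
proof -
  have "computable_pred (\<lambda>e. \<not> (\<exists>k<b e. \<not> P k e))" by (intro computable_intros assms)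
  thus ?thesis by simp
qed

lemma computable_pred_ball_le [computable_intros]:
  assumes "computable_pred (\<lambda>e. P (e 0) (\<lambda>i. e (Suc i)))" "computable b"
  shows "computable_pred (\<lambda>e. \<forall>k\<le>b e. P k e)"
  unfolding less_Suc_eq_le[symmetric] by (intro computable_intros assms)

lemma computable_Least:
  assumes "computable_pred (\<lambda>e. P (e 0) (\<lambda>i. e (Suc i)))" and ex: "\<And>e. \<exists>k. P k e"
  shows "computable (\<lambda>e. LEAST k. P k e)"
proof -
  have "computable (\<lambda>e. of_bool (\<not> P (e 0) (\<lambda>i. e (Suc i))))" by (intro computable_intros assms)
  then obtain n where "\<And>m. m \<ge> n \<Longrightarrow> \<exists>h. recursive_fun m h \<and>
      (\<forall>e. of_bool (\<not> P (e 0) (\<lambda>i. e (Suc i))) = h (map e [0..<m]))"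
    using computable_arity by blast
  then obtain h where h: "recursive_fun (Suc n) h"
    "\<And>e. of_bool (\<not> P (e 0) (\<lambda>i. e (Suc i))) = h (map e [0..<Suc n])"
    by (meson le_SucI order_refl)
  have h2: "h (k # map e [0..<n]) = of_bool (\<not> P k e)" for k e
    using h(2)[of "case_nat k e"] by (simp add: map_upt_Suc del: upt_Suc)
  have "\<exists>k. h (k # xs) = 0" if "length xs = n" for xs
  proof -
    have "xs = map (\<lambda>i. xs ! i) [0..<n]" using that map_nth by metis
    moreover obtain k where "P k (\<lambda>i. xs ! i)" using ex by blast
    ultimately show ?thesis using h2[of k "\<lambda>i. xs ! i"] by auto
  qed
  hence "recursive_fun n (\<lambda>xs. LEAST k. h (k # xs) = 0)"
    using h(1) by (intro rf_mu) auto
  moreover have "(LEAST k. P k e) = (LEAST k. h (k # map e [0..<n]) = 0)" for e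
    by (simp add: h2)
  ultimately show ?thesis unfolding computable_def by blast
qed

text \<open>
  A function with a computable graph is computable, by searching for its value.
\<close>

lemma computable_eqI:
  assumes "computable_pred (\<lambda>e. f (\<lambda>i. e (Suc i)) = e 0)"
  shows "computable f"
proof -
  have "computable (\<lambda>e. LEAST k. f e = k)"
    by (rule computable_Least) (use assms in auto)
  thus ?thesis by (simp add: Least_equality)
qed

lemma computable_min [computable_intros]:
  assumes "computable a" "computable b"
  shows "computable (\<lambda>e. min (a e) (b e) :: nat)"
  unfolding min_def by (intro computable_intros assms)

lemma computable_power [computable_intros]:
  assumes "computable a" "computable b"
  shows "computable (\<lambda>e. a e ^ b e)"
proof -
  have "rec_nat 1 (\<lambda>_ r. r * x) y = x ^ y" for x y :: nat by (induction y) auto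
  moreover have "computable (\<lambda>e. rec_nat 1 (\<lambda>_ r. r * e 0) (e 1))"
    by (intro computable_intros)
  ultimately have "computable (\<lambda>e. e 0 ^ e 1)" by simp
  from computable_comp2[OF this assms] show ?thesis .
qed

lemma computable_div [computable_intros]:
  assumes "computable a" "computable b"
  shows "computable (\<lambda>e. a e div b e)"
proof -
  have "computable (\<lambda>e. LEAST k. e 1 = 0 \<or> e 0 < Suc k * e 1)"
  proof (rule computable_Least)
    fix e :: "nat \<Rightarrow> nat"
    have "e 1 = 0 \<or> e 0 < Suc (e 0) * e 1" by (cases "e 1") auto
    thus "\<exists>k. e 1 = 0 \<or> e 0 < Suc k * e 1" by blast
  qed (intro computable_intros)
  moreover have "(LEAST k. y = 0 \<or> x < Suc k * y) = x div y" for x y :: nat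
  proof (cases "y = 0")
    case False
    hence "(y = 0 \<or> x < Suc k * y) \<longleftrightarrow> x div y \<le> k" for k
      using less_mult_imp_div_less[of x "Suc k" y] dividend_less_div_times[of y x]
      by (auto simp: div_less_iff_less_mult[symmetric] less_Suc_eq_le[symmetric] simp del: mult_Suc)
    thus ?thesis by (simp add: Least_equality)
  qed simp
  ultimately have "computable (\<lambda>e. e 0 div e 1)" by simp
  from computable_comp2[OF this assms] show ?thesis .
qed

lemma computable_mod [computable_intros]:
  assumes "computable a" "computable b"
  shows "computable (\<lambda>e. a e mod b e)"
proof -
  have "computable (\<lambda>e. e 0 - e 0 div e 1 * e 1)"
    by (intro computable_intros)
  hence "computable (\<lambda>e. e 0 mod e 1)" by (simp only: minus_div_mult_eq_mod)
  from computable_comp2[OF this assms] show ?thesis .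
qed

lemma computable_prod_encode [computable_intros]:
  assumes "computable a" "computable b"
  shows "computable (\<lambda>e. prod_encode (a e, b e))"
proof -
  have tri: "rec_nat 0 (\<lambda>k r. r + Suc k) n = triangle n" for n by (induction n) auto
  have "computable (\<lambda>e. rec_nat 0 (\<lambda>k r. r + Suc k) (e 0))" by (intro computable_intros)
  note tri_comp = computable_comp1[OF this[unfolded tri]]
  show ?thesis unfolding prod_encode_def by (simp, intro computable_intros tri_comp assms)
qed

lemma computable_fst_prod_decode [computable_intros]:
  assumes "computable a"
  shows "computable (\<lambda>e. fst (prod_decode (a e)))"
proof -
  have "fst (prod_decode n) = m \<longleftrightarrow> (\<exists>k\<le>n. prod_encode (m, k) = n)" for m n
    by (metis fst_conv le_prod_encode_2 prod.collapse prod_decode_inverse prod_encode_inverse)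
  moreover have "computable_pred (\<lambda>e. \<exists>k\<le>e 1. prod_encode (e 0, k) = e 1)"
    by (intro computable_intros)
  ultimately have "computable (\<lambda>e. fst (prod_decode (e 0)))"
    by (intro computable_eqI) simp
  from computable_comp1[OF this assms] show ?thesis .
qed

lemma computable_snd_prod_decode [computable_intros]:
  assumes "computable a"
  shows "computable (\<lambda>e. snd (prod_decode (a e)))"
proof -
  have "snd (prod_decode n) = m \<longleftrightarrow> (\<exists>k\<le>n. prod_encode (k, m) = n)" for m n
    by (metis snd_conv le_prod_encode_1 prod.collapse prod_decode_inverse prod_encode_inverse)
  moreover have "computable_pred (\<lambda>e. \<exists>k\<le>e 1. prod_encode (k, e 0) = e 1)"
    by (intro computable_intros)
  ultimately have "computable (\<lambda>e. snd (prod_decode (e 0)))"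
    by (intro computable_eqI) simp
  from computable_comp1[OF this assms] show ?thesis .
qed

lemma computable_pred_comp1:
  assumes "computable_pred (\<lambda>e. P (e 0))" "computable a"
  shows "computable_pred (\<lambda>e. P (a e))"
  using computable_comp1[of "\<lambda>n. of_bool (P n)"] assms by (simp add: computable_pred_def)

lemma computable_recursive_fun:
  assumes "recursive_fun 1 f" "computable a"
  shows "computable (\<lambda>e. f [a e])"
proof -
  have "computable (\<lambda>e. f [e 0])" unfolding computable_def using assms(1) by fastforce
  from computable_comp1[OF this assms(2)] show ?thesis .
qed

text \<open>
  An environment function may use more variables than the first one; filling all of them with the
  input gives a unary recursive function.
\<close>

lemma decidable_problemI:
  assumes "computable_pred (\<lambda>e. Q (e 0))" "\<And>i. i \<in> I \<Longrightarrow> Q (code i) \<longleftrightarrow> i \<in> P"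
  shows "decidable_problem code I P"
proof -
  obtain n where "\<And>m. m \<ge> n \<Longrightarrow> \<exists>g. recursive_fun m g \<and> (\<forall>e. of_bool (Q (e 0)) = g (map e [0..<m]))"
    using computable_arity[OF assms(1)[unfolded computable_pred_def]] by blast
  then obtain g where g: "recursive_fun (Suc n) g" "\<And>e. of_bool (Q (e 0)) = g (map e [0..<Suc n])"
    by (meson le_SucI order_refl)
  let ?ps = "replicate (Suc n) (\<lambda>xs. xs ! 0 :: nat)"
  have "recursive_fun 1 (\<lambda>xs. g (map (\<lambda>p. p xs) ?ps))"
    using g(1) by (intro rf_comp) (auto intro: rf_proj)
  moreover have "g (map (\<lambda>p. p [c]) ?ps) = of_bool (Q c)" for c
    using g(2)[of "\<lambda>_. c"] by (simp add: map_replicate_trivial map_replicate_const del: upt_Suc)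
  ultimately show ?thesis unfolding decidable_problem_def
    using assms(2) by (intro exI[of _ "\<lambda>xs. g (map (\<lambda>p. p xs) ?ps)"]) (auto simp del: replicate_Suc)
qed

section \<open>Lists, finite sets and words as numbers\<close>

text \<open>
  Every number codes a list: 0 the empty one, and otherwise \<open>prod_decode (c - 1)\<close> is the pair of the
  head and the code of the tail. Past the end of the list the value is 0, as \<open>prod_decode 0 = (0, 0)\<close>.
\<close>

definition code_nth :: "nat \<Rightarrow> nat \<Rightarrow> nat" where
  "code_nth c i = fst (prod_decode (rec_nat c (\<lambda>_ r. snd (prod_decode (r - 1))) i - 1))"

lemma code_nth_list_encode:
  assumes "i < length xs"
  shows "code_nth (list_encode xs) i = xs ! i"
proof -
  have "rec_nat (list_encode xs) (\<lambda>_ r. snd (prod_decode (r - 1))) i = list_encode (drop i xs)"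
    if "i \<le> length xs" using that
  proof (induction i)
    case (Suc i)
    hence "drop i xs = xs ! i # drop (Suc i) xs" by (simp add: Cons_nth_drop_Suc)
    thus ?case using Suc by simp
  qed simp
  with assms show ?thesis by (simp add: code_nth_def Cons_nth_drop_Suc[symmetric])
qed

lemma computable_code_nth [computable_intros]:
  assumes "computable a" "computable b"
  shows "computable (\<lambda>e. code_nth (a e) (b e))"
proof -
  have "computable (\<lambda>e. code_nth (e 0) (e 1))" unfolding code_nth_def by (intro computable_intros)
  from computable_comp2[OF this assms] show ?thesis .
qed

lemma computable_pred_set_decode [computable_intros]:
  assumes "computable a" "computable b"
  shows "computable_pred (\<lambda>e. a e \<in> set_decode (b e))"
  unfolding set_decode_def mem_Collect_eq odd_iff_mod_2_eq_one by (intro computable_intros assms)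

definition digit :: "nat \<Rightarrow> nat \<Rightarrow> nat \<Rightarrow> nat" where
  "digit s d i = d div s ^ i mod s"

lemma digits_exist:
  assumes "\<And>i. i < n \<Longrightarrow> g i < s"
  shows "\<exists>d<s ^ n. \<forall>i<n. digit s d i = g i"
  using assms
proof (induction n arbitrary: g)
  case (Suc n)
  from Suc.IH[of "\<lambda>i. g (Suc i)"] Suc.prems obtain d
    where d: "d < s ^ n" "\<And>i. i < n \<Longrightarrow> digit s d i = g (Suc i)" by auto
  have g0: "g 0 < s" using Suc.prems by simp
  have "digit s (g 0 + s * d) i = g i" if "i < Suc n" for i
    using that d(2) g0 by (cases i) (auto simp: digit_def div_mult2_eq)
  moreover have "g 0 + s * d < s ^ Suc n"
  proof -
    have "g 0 + s * d < s * Suc d" using g0 by simp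
    also have "\<dots> \<le> s * s ^ n" using d(1) by (intro mult_left_mono) auto
    finally show ?thesis by simp
  qed
  ultimately show ?case by blast
qed simp

text \<open>
  The words of length \<open>n\<close> over \<open>{..<s}\<close> correspond to the numbers below \<open>s ^ n\<close> through their
  base \<open>s\<close> digits, least significant first. This makes a quantifier over such words a bounded
  quantifier over numbers; \<open>digits_code\<close> translates a number to the list code of its word, built from
  the last letter backwards.
\<close>

definition digits_code :: "nat \<Rightarrow> nat \<Rightarrow> nat \<Rightarrow> nat" where
  "digits_code s d n = rec_nat 0 (\<lambda>k r. Suc (prod_encode (digit s d (n - Suc k), r))) n"

lemma digits_code_eq: "digits_code s d n = list_encode (map (digit s d) [0..<n])"
proof -
  have "rec_nat 0 (\<lambda>k r. Suc (prod_encode (digit s d (n - Suc k), r))) k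
      = list_encode (map (digit s d) [n - k..<n])" if "k \<le> n" for k
    using that
  proof (induction k)
    case (Suc k)
    hence "[n - Suc k..<n] = (n - Suc k) # [n - k..<n]"
      by (subst upt_conv_Cons) (auto simp: Suc_diff_Suc)
    thus ?case using Suc by simp
  qed simp
  from this[of n] show ?thesis by (simp add: digits_code_def)
qed

lemma computable_digit [computable_intros]:
  assumes "computable a" "computable b"
  shows "computable (\<lambda>e. digit s (a e) (b e))"
  unfolding digit_def by (intro computable_intros assms)

lemma computable_digits_code [computable_intros]:
  assumes "computable a" "computable b"
  shows "computable (\<lambda>e. digits_code s (a e) (b e))"
proof -
  have "computable (\<lambda>e. digits_code s (e 0) (e 1))"
    unfolding digits_code_def by (intro computable_intros)
  from computable_comp2[OF this assms] show ?thesis .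
qed

section \<open>Subshifts and their factors\<close>

lemma upt_append: "i \<le> j \<Longrightarrow> j \<le> k \<Longrightarrow> [i..<j] @ [j..<k] = [i..<k]"
  using upt_add_eq_append[of i j "k - j"] by simp

definition sequences :: "'a set \<Rightarrow> (nat \<Rightarrow> 'a) set" where
  "sequences S = {x. \<forall>i. x i \<in> S}"

text \<open>
  The product topology is generated by cylinders, so closedness means closedness under limits of prefixes.
\<close>

lemma closedin_sequences_iff:
  "closedin (product_topology (\<lambda>_. discrete_topology S) UNIV) X \<longleftrightarrow>
     X \<subseteq> sequences S \<and>
     (\<forall>x\<in>sequences S. (\<forall>n. \<exists>y\<in>X. \<forall>i<n. y i = x i) \<longrightarrow> x \<in> X)" (is "closedin ?T X \<longleftrightarrow> ?R")
proof -
  have top: "topspace ?T = sequences S"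
    by (auto simp: sequences_def PiE_iff)
  show ?thesis
  proof
    assume cl: "closedin ?T X"
    have "x \<in> X" if x: "x \<in> sequences S" and app: "\<forall>n. \<exists>y\<in>X. \<forall>i<n. y i = x i" for x
    proof (rule ccontr)
      assume "x \<notin> X"
      have "openin ?T (topspace ?T - X)" using cl by blast
      moreover have "x \<in> topspace ?T - X" using x \<open>x \<notin> X\<close> top by auto
      ultimately have "\<exists>U. finite {i \<in> UNIV. U i \<noteq> topspace (discrete_topology S)} \<and>
          (\<forall>i\<in>UNIV. openin (discrete_topology S) (U i)) \<and> x \<in> Pi\<^sub>E UNIV U \<and>
          Pi\<^sub>E UNIV U \<subseteq> topspace ?T - X"
        unfolding openin_product_topology_alt by (rule bspec)
      then obtain U where U: "finite {i. U i \<noteq> S}" "\<And>i. U i \<subseteq> S"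
          "x \<in> Pi\<^sub>E UNIV U" "Pi\<^sub>E UNIV U \<subseteq> topspace ?T - X"
        by (elim exE conjE) simp
      define n where "n = Suc (Max (insert 0 {i. U i \<noteq> S}))"
      have n: "U i = S" if "i \<ge> n" for i
      proof (rule ccontr)
        assume "U i \<noteq> S"
        hence "i \<le> Max (insert 0 {i. U i \<noteq> S})" using U(1) by (intro Max_ge) auto
        thus False using that by (simp add: n_def)
      qed
      obtain y where y: "y \<in> X" "\<forall>i<n. y i = x i" using app by blast
      have "y i \<in> U i" for i
      proof (cases "i < n")
        case True
        thus ?thesis using y(2) U(3) by (auto simp: PiE_iff)
      next
        case False
        have "y \<in> sequences S" using y(1) closedin_subset[OF cl] top by auto
        thus ?thesis using False n[of i] by (auto simp: sequences_def)
      qed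
      hence "y \<in> Pi\<^sub>E UNIV U" by auto
      thus False using U(4) y(1) by auto
    qed
    moreover have "X \<subseteq> sequences S" using closedin_subset[OF cl] top by auto
    ultimately show ?R by blast
  next
    assume R: ?R
    have "openin ?T (topspace ?T - X)"
      unfolding openin_product_topology_alt
    proof
      fix x assume "x \<in> topspace ?T - X"
      hence x: "x \<in> sequences S" "x \<notin> X" using top by auto
      then obtain n where n: "\<And>y. y \<in> X \<Longrightarrow> \<exists>i<n. y i \<noteq> x i" using R by blast
      let ?U = "\<lambda>i. if i < n then {x i} else S"
      have "{i. ?U i \<noteq> S} \<subseteq> {..<n}" by auto
      hence "finite {i. ?U i \<noteq> S}" by (rule finite_subset) simp
      moreover have "?U i \<subseteq> S" for i using x(1) by (auto simp: sequences_def)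
      moreover have "x \<in> Pi\<^sub>E UNIV ?U" using x(1) by (auto simp: sequences_def PiE_iff)
      moreover have "Pi\<^sub>E UNIV ?U \<subseteq> topspace ?T - X"
      proof
        fix y assume y: "y \<in> Pi\<^sub>E UNIV ?U"
        hence yU: "\<And>i. y i \<in> ?U i" by (auto simp: PiE_iff)
        have "\<And>i. i < n \<Longrightarrow> y i = x i" using yU by (metis singletonD)
        hence "y \<notin> X" using n by blast
        moreover have "y \<in> sequences S"
          using yU \<open>\<And>i. ?U i \<subseteq> S\<close> by (fastforce simp: sequences_def)
        ultimately show "y \<in> topspace ?T - X" using top by auto
      qed
      ultimately show "\<exists>U. finite {i \<in> UNIV. U i \<noteq> topspace (discrete_topology S)} \<and>
          (\<forall>i\<in>UNIV. openin (discrete_topology S) (U i)) \<and> x \<in> Pi\<^sub>E UNIV U \<and>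
          Pi\<^sub>E UNIV U \<subseteq> topspace ?T - X"
        by (intro exI[of _ ?U]) simp
    qed
    moreover have "X \<subseteq> topspace ?T" using R top by auto
    ultimately show "closedin ?T X" by (simp add: closedin_def)
  qed
qed

lemma subshift_iff:
  "subshift S X \<longleftrightarrow> X \<subseteq> sequences S \<and> shift_map ` X \<subseteq> X \<and>
     (\<forall>x\<in>sequences S. (\<forall>n. \<exists>y\<in>X. \<forall>i<n. y i = x i) \<longrightarrow> x \<in> X)"
  unfolding subshift_def closedin_sequences_iff by (simp only: conj_ac)

lemma subshift_letter:
  assumes "subshift S X" "x \<in> X"
  shows "x i \<in> S"
proof -
  have "X \<subseteq> sequences S" using assms(1) unfolding subshift_iff by (elim conjE)
  thus ?thesis using assms(2) by (auto simp: sequences_def)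
qed

lemma subshift_limit:
  assumes "subshift S X" "z \<in> sequences S" "\<And>n. \<exists>y\<in>X. \<forall>i<n. y i = z i"
  shows "z \<in> X"
proof -
  have "\<forall>x\<in>sequences S. (\<forall>n. \<exists>y\<in>X. \<forall>i<n. y i = x i) \<longrightarrow> x \<in> X"
    using assms(1) unfolding subshift_iff by (elim conjE)
  from bspec[OF this assms(2)] show ?thesis using assms(3) by simp
qed

definition drop_seq :: "nat \<Rightarrow> (nat \<Rightarrow> 'a) \<Rightarrow> nat \<Rightarrow> 'a" where
  "drop_seq k x = (\<lambda>i. x (k + i))"

lemma drop_seq_0 [simp]: "drop_seq 0 x = x"
  and drop_seq_drop_seq [simp]: "drop_seq j (drop_seq k x) = drop_seq (k + j) x"
  and drop_seq_apply [simp]: "drop_seq k x i = x (k + i)"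
  by (auto simp: drop_seq_def add_ac)

lemma drop_seq_Suc: "drop_seq (Suc k) x = shift_map (drop_seq k x)"
  by (auto simp: drop_seq_def shift_map_def)

lemma drop_seq_in_subshift: "subshift S X \<Longrightarrow> x \<in> X \<Longrightarrow> drop_seq k x \<in> X"
  by (induction k) (auto simp: drop_seq_Suc subshift_def)

lemma map_drop_seq: "map (drop_seq k x) [i..<j] = map x [k + i..<k + j]"
  by (rule nth_equalityI) (auto simp: add_ac)

definition factors :: "(nat \<Rightarrow> 'a) \<Rightarrow> 'a list set" where
  "factors x = {map x [i..<i + n] | i n. True}"

lemma factorsI: "map x [i..<i + n] \<in> factors x"
  by (auto simp: factors_def)

lemma factorsI': "i \<le> j \<Longrightarrow> map x [i..<j] \<in> factors x"
  using factorsI[of x i "j - i"] by simp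

lemma factors_iff: "w \<in> factors x \<longleftrightarrow> (\<exists>i. map x [i..<i + length w] = w)"
proof
  assume "w \<in> factors x"
  then obtain i n where w: "w = map x [i..<i + n]" by (auto simp: factors_def)
  hence "length w = n" by simp
  thus "\<exists>i. map x [i..<i + length w] = w" using w by metis
next
  assume "\<exists>i. map x [i..<i + length w] = w"
  thus "w \<in> factors x" using factorsI by metis
qed

lemma factors_drop_seq_iff: "w \<in> factors (drop_seq k x) \<longleftrightarrow> (\<exists>i\<ge>k. map x [i..<i + length w] = w)"
proof -
  have "w \<in> factors (drop_seq k x) \<longleftrightarrow> (\<exists>i. map x [k + i..<k + i + length w] = w)"
    unfolding factors_iff map_drop_seq add.assoc ..
  also have "\<dots> \<longleftrightarrow> (\<exists>i\<ge>k. map x [i..<i + length w] = w)"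
    by (auto simp: le_iff_add)
  finally show ?thesis .
qed

lemma factors_drop_seq_antimono: "j \<le> k \<Longrightarrow> factors (drop_seq k x) \<subseteq> factors (drop_seq j x)"
proof
  fix w assume "j \<le> k" "w \<in> factors (drop_seq k x)"
  then obtain i where "i \<ge> k" "map x [i..<i + length w] = w"
    unfolding factors_drop_seq_iff by (elim exE conjE)
  with \<open>j \<le> k\<close> show "w \<in> factors (drop_seq j x)"
    unfolding factors_drop_seq_iff by (intro exI[of _ i] conjI) simp_all
qed

lemma factors_drop_seq_subset: "factors (drop_seq k x) \<subseteq> factors x"
  using factors_drop_seq_antimono[of 0 k x] by simp

text \<open>
  The points of \<open>X\<close> whose factors are among those of \<open>x\<close> form the orbit closure of \<open>x\<close>. It is a subshift of
  \<open>X\<close>, and the factors of \<open>x\<close> can be recovered from it.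
\<close>

lemma quasiminimal_finite_factors:
  assumes "subshift S X" "quasiminimal S X"
  shows "finite (factors ` X)"
proof -
  define orbit_closure where "orbit_closure = (\<lambda>x. {y \<in> X. factors y \<subseteq> factors x})"
  have "subshift S (orbit_closure x)" for x
    unfolding subshift_iff
  proof (intro conjI ballI impI)
    show "orbit_closure x \<subseteq> sequences S" using assms(1) by (auto simp: orbit_closure_def subshift_iff)
    show "shift_map ` orbit_closure x \<subseteq> orbit_closure x"
    proof (intro image_subsetI)
      fix y assume y: "y \<in> orbit_closure x"
      have "shift_map y = drop_seq 1 y" by (simp add: drop_seq_Suc)
      thus "shift_map y \<in> orbit_closure x"
        using y drop_seq_in_subshift[OF assms(1)] factors_drop_seq_subset[of 1 y]
        by (auto simp: orbit_closure_def)
    qed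
  next
    fix z assume z: "z \<in> sequences S" and app: "\<forall>n. \<exists>y\<in>orbit_closure x. \<forall>i<n. y i = z i"
    have "\<forall>n. \<exists>y\<in>X. \<forall>i<n. y i = z i"
    proof
      fix n
      from app[rule_format, of n] show "\<exists>y\<in>X. \<forall>i<n. y i = z i" by (auto simp: orbit_closure_def)
    qed
    hence "z \<in> X" by (intro subshift_limit[OF assms(1) z]) simp
    moreover have "w \<in> factors x" if w: "w \<in> factors z" for w
    proof -
      obtain i where i: "map z [i..<i + length w] = w"
        using w unfolding factors_iff by (elim exE)
      obtain y where y: "y \<in> orbit_closure x" "\<forall>j<i + length w. y j = z j"
        using app[rule_format, of "i + length w"] by auto
      have "map y [i..<i + length w] = w"
      proof -
        have "map y [i..<i + length w] = map z [i..<i + length w]" using y(2) by simp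
        thus ?thesis using i by simp
      qed
      hence "w \<in> factors y" unfolding factors_iff by (rule exI)
      thus ?thesis using y(1) by (auto simp: orbit_closure_def)
    qed
    ultimately show "z \<in> orbit_closure x" by (auto simp: orbit_closure_def)
  qed
  moreover have orbit_closure_subset: "orbit_closure x \<subseteq> X" for x by (auto simp: orbit_closure_def)
  ultimately have "orbit_closure ` X \<subseteq> insert X {Y. subshift S Y \<and> Y \<subset> X}"
    by (simp add: image_subset_iff psubset_eq)
  moreover have "finite \<dots>" using assms(2) by (simp add: quasiminimal_def)
  ultimately have "finite (orbit_closure ` X)" by (rule finite_subset)
  hence fin: "finite ((\<lambda>Y. \<Union>y\<in>Y. factors y) ` orbit_closure ` X)" by simp
  have "(\<Union>y\<in>orbit_closure x. factors y) = factors x" if "x \<in> X" for x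
    using that by (auto simp: orbit_closure_def)
  hence "(\<lambda>Y. \<Union>y\<in>Y. factors y) ` orbit_closure ` X = factors ` X"
    unfolding image_image by (intro image_cong) simp_all
  thus ?thesis using fin by (simp only:)
qed

text \<open>
  The only factors of a sequence that its shift could miss are those occurring at position 0
  alone. Prolonging such an occurrence by one letter to the left gives a factor of the previous
  sequence, and by assumption that factor occurs again later.
\<close>

lemma factors_stable_step:
  assumes "factors (drop_seq (Suc i) x) = factors (drop_seq i x)"
  shows "factors (drop_seq (Suc (Suc i)) x) = factors (drop_seq (Suc i) x)"
proof
  show "factors (drop_seq (Suc i) x) \<subseteq> factors (drop_seq (Suc (Suc i)) x)"
  proof
    fix u assume "u \<in> factors (drop_seq (Suc i) x)"
    then obtain j where j: "j \<ge> Suc i" "map x [j..<j + length u] = u"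
      unfolding factors_drop_seq_iff by blast
    show "u \<in> factors (drop_seq (Suc (Suc i)) x)"
    proof (cases "j \<ge> Suc (Suc i)")
      case False
      hence [simp]: "j = Suc i" using j(1) by simp
      let ?v = "map x [i..<i + Suc (length u)]"
      have "?v \<in> factors (drop_seq i x)" unfolding factors_drop_seq_iff by (intro exI[of _ i]) simp
      then obtain k where k: "k \<ge> Suc i" "map x [k..<k + Suc (length u)] = ?v"
        unfolding assms[symmetric] factors_drop_seq_iff by auto
      have "map x [Suc k..<Suc k + length u] = tl (map x [k..<k + Suc (length u)])"
        by (simp add: upt_conv_Cons del: upt_Suc)
      also have "\<dots> = u" unfolding k(2) using j(2) by (simp add: upt_conv_Cons del: upt_Suc)
      finally show ?thesis using k(1) unfolding factors_drop_seq_iff by (intro exI[of _ "Suc k"]) simp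
    qed (use j in \<open>auto simp: factors_drop_seq_iff\<close>)
  qed
qed (simp add: factors_drop_seq_antimono)

lemma factors_stable:
  assumes "factors (drop_seq (Suc i) x) = factors (drop_seq i x)" "j \<ge> i"
  shows "factors (drop_seq j x) = factors (drop_seq i x)"
proof -
  have "factors (drop_seq (Suc j) x) = factors (drop_seq j x)" if "j \<ge> i" for j
    using that
  proof (induction j rule: dec_induct)
    case base
    show ?case by (rule assms(1))
  next
    case (step n)
    thus ?case by (intro factors_stable_step)
  qed
  with \<open>j \<ge> i\<close> show ?thesis by (induction j rule: dec_induct) auto
qed

text \<open>
  Before stabilising, the sets of factors of the successive shifts are pairwise distinct, so there
  cannot be more of them than sets of factors in \<open>X\<close>.
\<close>

lemma factors_eventually_stable:
  assumes X: "subshift S X" and fin: "finite (factors ` X)" and x: "x \<in> X"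
    and j: "j \<ge> card (factors ` X)"
  shows "factors (drop_seq j x) = factors (drop_seq (card (factors ` X)) x)"
proof -
  let ?N = "card (factors ` X)" and ?f = "\<lambda>i. factors (drop_seq i x)"
  have "\<exists>i<?N. ?f (Suc i) = ?f i"
  proof (rule ccontr)
    assume "\<not> ?thesis"
    hence step: "?f (Suc i) \<subset> ?f i" if "i < ?N" for i
      unfolding psubset_eq using that factors_drop_seq_antimono[of i "Suc i" x] by simp
    have less: "?f k \<subset> ?f i" if "i < k" "k \<le> ?N" for i k
    proof -
      have "?f k \<subseteq> ?f (Suc i)" using that by (intro factors_drop_seq_antimono) simp
      also have "\<dots> \<subset> ?f i" using that by (intro step) simp
      finally show ?thesis .
    qed
    have inj: "inj_on ?f {..?N}"
    proof (rule linorder_inj_onI')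
      fix i k assume "i \<in> {..?N}" "k \<in> {..?N}" "i < k"
      thus "?f i \<noteq> ?f k" using less[of i k] by auto
    qed
    have "?f ` {..?N} \<subseteq> factors ` X"
      using drop_seq_in_subshift[OF X x] by (intro image_subsetI imageI)
    hence "card (?f ` {..?N}) \<le> ?N" by (intro card_mono fin)
    thus False by (simp add: card_image[OF inj])
  qed
  then obtain i where i: "i < ?N" "?f (Suc i) = ?f i" by (elim exE conjE)
  have "?f k = ?f i" if "k \<ge> ?N" for k
    using i(1) that by (intro factors_stable[OF i(2)]) simp
  from this[OF j] this[of ?N] show ?thesis by (simp only: order_refl)
qed

text \<open>
  By shift invariance an occurrence of a word can be moved to position 0.
\<close>

lemma language_prefixes:
  assumes "subshift S X"
  shows "w \<in> language X \<longleftrightarrow> (\<exists>x\<in>X. w = map x [0..<length w])"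
proof
  assume "w \<in> language X"
  then obtain x i n where x: "x \<in> X" "w = map x [i..<i + n]" by (auto simp: language_def)
  have "w = map (drop_seq i x) [0..<length w]" unfolding map_drop_seq using x(2) by simp
  thus "\<exists>x\<in>X. w = map x [0..<length w]" using drop_seq_in_subshift[OF assms x(1)] by blast
next
  assume "\<exists>x\<in>X. w = map x [0..<length w]"
  then obtain x where "x \<in> X" "w = map x [0..<0 + length w]" by auto
  thus "w \<in> language X" unfolding language_def by blast
qed

section \<open>Uniformly recurrent tails\<close>

text \<open>
  Koenig's lemma: a word that is a prefix of infinitely many of the sequences has an extension by
  one letter with the same property.
\<close>

lemma sequences_compact:
  assumes fin: "finite S" and ys: "\<And>n. ys n \<in> sequences S"
  shows "\<exists>z\<in>sequences S. \<forall>N. \<exists>n\<ge>N. \<forall>i<N. ys n i = z i"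
proof -
  define P where "P = (\<lambda>w. set w \<subseteq> S \<and> infinite {n. map (ys n) [0..<length w] = w})"
  have P_Nil: "P []" by (simp add: P_def)
  have ext: "\<exists>a. P (w @ [a])" if "P w" for w
  proof -
    have "{n. map (ys n) [0..<length w] = w}
        = (\<Union>a\<in>S. {n. map (ys n) [0..<length (w @ [a])] = w @ [a]})"
      using ys by (auto simp: sequences_def)
    moreover have "infinite {n. map (ys n) [0..<length w] = w}" using that by (simp add: P_def)
    ultimately have "\<exists>a\<in>S. infinite {n. map (ys n) [0..<length (w @ [a])] = w @ [a]}"
      using fin by auto
    thus ?thesis using that by (auto simp: P_def)
  qed
  then obtain h where h: "\<And>w. P w \<Longrightarrow> P (w @ [h w])" by metis
  define W where "W = rec_nat [] (\<lambda>_ w. w @ [h w])"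
  have W_Suc: "W (Suc n) = W n @ [h (W n)]" and W_0: "W 0 = []" for n by (simp_all add: W_def)
  have len: "length (W n) = n" for n by (induction n) (simp_all add: W_Suc W_0)
  have PW: "P (W n)" for n by (induction n) (simp_all add: W_Suc W_0 P_Nil h)
  define z where "z = (\<lambda>i. h (W i))"
  have W_z: "W n = map z [0..<n]" for n by (induction n) (simp_all add: W_Suc W_0 z_def)
  have "z \<in> sequences S"
    unfolding sequences_def
  proof (intro CollectI allI)
    fix i
    have "set (W (Suc i)) \<subseteq> S" using PW by (simp add: P_def)
    thus "z i \<in> S" by (simp add: W_Suc z_def)
  qed
  moreover have "\<exists>n\<ge>N. \<forall>i<N. ys n i = z i" for N
  proof -
    have "infinite {n. map (ys n) [0..<N] = map z [0..<N]}"
      using PW[of N] by (simp add: P_def W_z)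
    then obtain n where n: "n \<ge> N" "map (ys n) [0..<N] = map z [0..<N]"
      unfolding infinite_nat_iff_unbounded_le by auto
    from n(2) have "ys n i = z i" if "i < N" for i using that by (simp add: map_eq_conv)
    thus ?thesis using n(1) by blast
  qed
  ultimately show ?thesis by blast
qed

definition occurs_at :: "'a list \<Rightarrow> (nat \<Rightarrow> 'a) \<Rightarrow> nat \<Rightarrow> bool" where
  "occurs_at u x k \<longleftrightarrow> map x [k..<k + length u] = u"

lemma occurs_at_drop_seq [simp]: "occurs_at u (drop_seq j x) k \<longleftrightarrow> occurs_at u x (j + k)"
  by (simp add: occurs_at_def map_drop_seq add.assoc)

lemma occurs_at_cong: "(\<And>i. i < k + length u \<Longrightarrow> x i = y i) \<Longrightarrow> occurs_at u x k \<longleftrightarrow> occurs_at u y k"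
  unfolding occurs_at_def by (rule arg_cong[where f = "\<lambda>w. w = u"]) simp

lemma occurs_at_append:
  "occurs_at (w @ u) x s \<longleftrightarrow> occurs_at w x s \<and> occurs_at u x (s + length w)"
proof -
  have "[s..<s + length (w @ u)] = [s..<s + length w] @ [s + length w..<s + length w + length u]"
    by (simp only: length_append add.assoc[symmetric], intro upt_append[symmetric]) simp_all
  thus ?thesis unfolding occurs_at_def by simp
qed

lemma factors_occurs: "u \<in> factors x \<longleftrightarrow> (\<exists>k. occurs_at u x k)"
  by (simp only: factors_iff occurs_at_def)

text \<open>
  Every factor returns with bounded gaps; phrased in terms of factors only, so that sequences with the
  same factors share the bound.
\<close>

definition uniformly_recurrent :: "(nat \<Rightarrow> 'a) \<Rightarrow> bool" where
  "uniformly_recurrent x \<longleftrightarrow>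
     (\<forall>u\<in>factors x. \<exists>R. \<forall>v\<in>factors x. length v = R \<longrightarrow>
        (\<exists>a b. v = a @ u @ b))"

lemma last_occurrence:
  fixes Q :: "nat \<Rightarrow> bool"
  assumes "Q p0" "p0 < t"
  obtains p where "p0 \<le> p" "p < t" "Q p" "\<And>k. p < k \<Longrightarrow> k < t \<Longrightarrow> \<not> Q k"
proof -
  let ?A = "{k. k < t \<and> Q k}"
  have A: "finite ?A" "?A \<noteq> {}" using assms by auto
  show ?thesis
  proof (rule that)
    show "p0 \<le> Max ?A" using A assms by (intro Max_ge) auto
    show "Max ?A < t" "Q (Max ?A)" using Max_in[OF A] by auto
    fix k assume "Max ?A < k" "k < t"
    thus "\<not> Q k" using Max_ge[OF A(1), of k] by (auto simp del: Max_ge)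
  qed
qed

text \<open>
  If \<open>u\<close> does not return with bounded gaps, a compactness argument produces a point of \<open>X\<close> in which \<open>u\<close>
  occurs at position \<open>N\<close> and never later. This is impossible since the factors of its shifts are constant
  from the \<open>N\<close>-th shift on.
\<close>

lemma uniformly_recurrent_tail:
  assumes S: "finite S" and X: "subshift S X" and fin: "finite (factors ` X)" and x: "x \<in> X"
  shows "uniformly_recurrent (drop_seq (card (factors ` X)) x)"
  unfolding uniformly_recurrent_def
proof (rule ballI, rule ccontr)
  let ?N = "card (factors ` X)"
  fix u assume u: "u \<in> factors (drop_seq ?N x)"
    and neg: "\<not> (\<exists>R. \<forall>v\<in>factors (drop_seq ?N x). length v = R \<longrightarrow> (\<exists>a b. v = a @ u @ b))"
  obtain p0 where p0: "p0 \<ge> ?N" "occurs_at u x p0"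
    using u unfolding factors_drop_seq_iff occurs_at_def by (elim exE conjE)
  have "\<exists>y\<in>X. occurs_at u y ?N \<and> (\<forall>k. ?N < k \<and> k \<le> ?N + n \<longrightarrow> \<not> occurs_at u y k)" for n
  proof -
    \<comment> \<open>A factor of this length without \<open>u\<close> starts beyond \<open>p0\<close>, and it leaves a gap of length at least
      \<open>n\<close> after the last occurrence of \<open>u\<close> preceding it.\<close>
    define R where "R = n + p0 + length u"
    obtain v where v: "v \<in> factors (drop_seq ?N x)" "length v = R" "\<not> (\<exists>a b. v = a @ u @ b)"
      using neg by blast
    obtain t where t: "t \<ge> ?N" "map x [t..<t + R] = v"
      using v(1,2) unfolding factors_drop_seq_iff by auto
    have none: "\<not> occurs_at u x k" if "t \<le> k" "k + length u \<le> t + R" for k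
    proof
      assume "occurs_at u x k"
      have "[t..<t + R] = [t..<k] @ [k..<k + length u] @ [k + length u..<t + R]"
        using that by (simp add: upt_append)
      hence "v = map x [t..<k] @ u @ map x [k + length u..<t + R]"
        using \<open>occurs_at u x k\<close> t(2) by (simp add: occurs_at_def)
      with v(3) show False by blast
    qed
    have "p0 < t"
    proof (rule ccontr)
      assume "\<not> p0 < t"
      with none[of p0] p0(2) show False by (simp add: R_def)
    qed
    from p0(2) this obtain p where p: "p0 \<le> p" "p < t" "occurs_at u x p"
      "\<And>k. p < k \<Longrightarrow> k < t \<Longrightarrow> \<not> occurs_at u x k"
      by (rule last_occurrence) blast
    have far: "\<not> occurs_at u x k" if "p < k" "k \<le> p + n" for k
    proof (cases "k < t")
      case False
      thus ?thesis using that p(2) by (intro none) (simp_all add: R_def)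
    qed (use p(4) that in simp)
    show ?thesis
    proof (intro bexI[of _ "drop_seq (p - ?N) x"] conjI allI impI)
      show "drop_seq (p - ?N) x \<in> X" using drop_seq_in_subshift[OF X x] .
      show "occurs_at u (drop_seq (p - ?N) x) ?N" using p0(1) p(1,3) by simp
      fix k assume "?N < k \<and> k \<le> ?N + n"
      thus "\<not> occurs_at u (drop_seq (p - ?N) x) k" using p0(1) p(1)
        by (simp, intro far) auto
    qed
  qed
  then obtain ys where ys: "\<And>n. ys n \<in> X" "\<And>n. occurs_at u (ys n) ?N"
    "\<And>n k. ?N < k \<Longrightarrow> k \<le> ?N + n \<Longrightarrow> \<not> occurs_at u (ys n) k" by metis
  have XS: "X \<subseteq> sequences S" using X by (simp add: subshift_iff)
  obtain z where z: "z \<in> sequences S" "\<And>N. \<exists>n\<ge>N. \<forall>i<N. ys n i = z i"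
    using sequences_compact[OF S, of ys] ys(1) XS by blast
  have zX: "z \<in> X" using z ys(1) by (intro subshift_limit[OF X]) blast+
  have "u \<in> factors (drop_seq ?N z)"
  proof -
    obtain n where "\<forall>i<?N + length u. ys n i = z i" using z(2) by blast
    hence "occurs_at u z ?N" using ys(2)[of n] occurs_at_cong[of ?N u "ys n" z] by simp
    thus ?thesis unfolding factors_occurs by (intro exI[of _ 0]) simp
  qed
  moreover have "factors (drop_seq (Suc ?N) z) = factors (drop_seq ?N z)"
    by (rule factors_eventually_stable[OF X fin zX]) simp
  ultimately have "u \<in> factors (drop_seq (Suc ?N) z)" by (simp only:)
  then obtain k where k: "k \<ge> Suc ?N" "occurs_at u z k"
    unfolding factors_drop_seq_iff occurs_at_def by (elim exE conjE)
  obtain n where n: "n \<ge> k + length u" "\<forall>i<k + length u. ys n i = z i" using z(2) by blast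
  hence "occurs_at u (ys n) k" using k(2) occurs_at_cong[of k u "ys n" z] by simp
  thus False using ys(3)[of k n] k(1) n(1) by simp
qed

section \<open>Runs on uniformly recurrent sequences\<close>

primrec run :: "('q \<Rightarrow> 'a \<Rightarrow> 'q) \<Rightarrow> 'q \<Rightarrow> (nat \<Rightarrow> 'a) \<Rightarrow> nat \<Rightarrow> 'q" where
  "run \<delta> q x 0 = q"
| "run \<delta> q x (Suc t) = \<delta> (run \<delta> q x t) (x t)"

text \<open>
  The states visited at the \<open>R\<close> times starting with time \<open>t\<close>.
\<close>

definition window :: "('q \<Rightarrow> 'a \<Rightarrow> 'q) \<Rightarrow> 'q \<Rightarrow> (nat \<Rightarrow> 'a) \<Rightarrow> nat \<Rightarrow> nat \<Rightarrow> 'q set" where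
  "window \<delta> q x t R = run \<delta> q x ` {t..<t + R}"

lemma run_add: "run \<delta> q x (j + t) = run \<delta> (run \<delta> q x j) (drop_seq j x) t"
  by (induction t) simp_all

lemma run_eq_foldl: "run \<delta> q x t = foldl \<delta> q (map x [0..<t])"
  by (induction t) simp_all

lemma run_later: "s \<le> t \<Longrightarrow> run \<delta> q x t = foldl \<delta> (run \<delta> q x s) (map x [s..<t])"
  by (induction t rule: dec_induct) simp_all

lemma run_cong: "(\<And>i. i < t \<Longrightarrow> x i = y i) \<Longrightarrow> run \<delta> q x t = run \<delta> q y t"
  by (induction t) simp_all

lemma window_drop_seq: "window \<delta> q x (j + t) R = window \<delta> (run \<delta> q x j) (drop_seq j x) t R"
proof -
  have "{j + t..<j + t + R} = (\<lambda>k. j + k) ` {t..<t + R}"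
    by (simp add: add_ac)
  thus ?thesis unfolding window_def by (simp only: image_image run_add)
qed

text \<open>
  The initial and the final state are included.
\<close>

definition visits :: "('q \<Rightarrow> 'a \<Rightarrow> 'q) \<Rightarrow> 'a list \<Rightarrow> 'q \<Rightarrow> 'q set" where
  "visits \<delta> u p = (\<lambda>k. foldl \<delta> p (take k u)) ` {..length u}"

lemma visits_append: "visits \<delta> u p \<subseteq> visits \<delta> (u @ v) p"
proof
  fix r assume "r \<in> visits \<delta> u p"
  then obtain k where "k \<le> length u" "r = foldl \<delta> p (take k u)" by (auto simp: visits_def)
  thus "r \<in> visits \<delta> (u @ v) p" unfolding visits_def by (intro image_eqI[of _ _ k]) auto
qed

lemma foldl_in_visits: "foldl \<delta> p u \<in> visits \<delta> u p"
  unfolding visits_def by (intro image_eqI[of _ _ "length u"]) auto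

lemma run_comp: "run (\<lambda>q a. \<delta> q (f a)) q x t = run \<delta> q (f \<circ> x) t"
  by (induction t) simp_all

lemma window_comp: "window (\<lambda>q a. \<delta> q (f a)) q x t R = window \<delta> q (f \<circ> x) t R"
  by (simp add: window_def run_comp)

lemma ex_run_iff_window: "(\<exists>k<R. run \<delta> q x (t + k) = p) \<longleftrightarrow> p \<in> window \<delta> q x t R"
proof -
  have "{t..<t + R} = (\<lambda>k. t + k) ` {..<R}" by (simp add: lessThan_atLeast0 add.commute)
  thus ?thesis unfolding window_def by (auto simp: image_image)
qed

lemma window_cong:
  "(\<And>i. i < t + R \<Longrightarrow> x i = y i) \<Longrightarrow> window \<delta> q x t R = window \<delta> q y t R"
  unfolding window_def by (intro image_cong run_cong) auto

context
  fixes \<delta> :: "'q \<Rightarrow> 'a \<Rightarrow> 'q" and Q :: "'q set"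
  assumes Q: "finite Q" and \<delta>: "\<And>q a. q \<in> Q \<Longrightarrow> \<delta> q a \<in> Q"
begin

lemma foldl_in: "q \<in> Q \<Longrightarrow> foldl \<delta> q w \<in> Q"
  by (induction w arbitrary: q) (auto intro: \<delta>)

lemma run_in: "q \<in> Q \<Longrightarrow> run \<delta> q x t \<in> Q"
  by (simp add: run_eq_foldl foldl_in)

lemma visits_subset: "p \<in> Q \<Longrightarrow> visits \<delta> u p \<subseteq> Q"
  by (auto simp: visits_def foldl_in)

lemma finite_visits: "finite (visits \<delta> u p)"
  by (simp add: visits_def)

text \<open>
  The word \<open>w\<close> minimises the size of the image of its action on the states, so any factor ending in \<open>w\<close> has
  the same image; and \<open>u\<close> maximises the total number of states visited from that image, so nothing
  new is visited when \<open>u\<close> is continued.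
\<close>

lemma saturating_word:
  fixes x :: "nat \<Rightarrow> 'a"
  obtains w u where "w @ u \<in> factors x"
    and "\<And>v. v @ w \<in> factors x \<Longrightarrow> (\<lambda>q. foldl \<delta> q (v @ w)) ` Q = (\<lambda>q. foldl \<delta> q w) ` Q"
    and "\<And>p v. p \<in> (\<lambda>q. foldl \<delta> q w) ` Q \<Longrightarrow> w @ u @ v \<in> factors x \<Longrightarrow>
           visits \<delta> (u @ v) p = visits \<delta> u p"
proof -
  let ?im = "\<lambda>w. (\<lambda>q. foldl \<delta> q w) ` Q"
  have "[] \<in> factors x" using factorsI[of x 0 0] by simp
  then obtain w where w: "w \<in> factors x" "\<And>w'. w' \<in> factors x \<Longrightarrow> card (?im w) \<le> card (?im w')"
    using ex_has_least_nat[of "\<lambda>w. w \<in> factors x" "[]" "\<lambda>w. card (?im w)"] by blast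
  define B where "B = ?im w"
  have BQ: "B \<subseteq> Q" by (auto simp: B_def foldl_in)
  have finB: "finite B" using BQ Q by (rule finite_subset)
  have im: "?im (v @ w) = ?im w" if "v @ w \<in> factors x" for v
  proof (rule card_subset_eq)
    show "finite (?im w)" using Q by simp
    show "?im (v @ w) \<subseteq> ?im w" by (auto simp: foldl_in)
    thus "card (?im (v @ w)) = card (?im w)"
      using w(2)[OF that] card_mono[OF \<open>finite (?im w)\<close>] by (intro antisym) auto
  qed
  let ?m = "\<lambda>u. \<Sum>p\<in>B. card (visits \<delta> u p)"
  have bound: "?m u \<le> card B * card Q" for u
    using sum_bounded_above[of B "\<lambda>p. card (visits \<delta> u p)" "card Q"] BQ visits_subset Q
    by (auto intro!: card_mono)
  obtain u where u: "w @ u \<in> factors x" "\<And>u'. w @ u' \<in> factors x \<Longrightarrow> ?m u' \<le> ?m u"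
    using ex_has_greatest_nat[of "\<lambda>u. w @ u \<in> factors x" "[]" ?m "Suc (card B * card Q)"] w(1) bound
    by (auto simp: less_Suc_eq_le)
  have "visits \<delta> (u @ v) p = visits \<delta> u p" if p: "p \<in> B" and v: "w @ u @ v \<in> factors x" for p v
  proof (rule ccontr)
    assume "visits \<delta> (u @ v) p \<noteq> visits \<delta> u p"
    hence "card (visits \<delta> u p) < card (visits \<delta> (u @ v) p)"
      using visits_append[of \<delta> u p v] by (intro psubset_card_mono finite_visits) auto
    hence "?m u < ?m (u @ v)"
      using finB p by (intro sum_strict_mono_ex1 ballI bexI[of _ p] card_mono finite_visits visits_append)
    with u(2)[OF v] show False by simp
  qed
  with that[of w u] u(1) im show ?thesis unfolding B_def by blast
qed

text \<open>
  The bound is obtained from the factors of \<open>y\<close> alone and therefore serves all sequences with the same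
  factors.
\<close>

lemma windows_stabilize_uniformly_recurrent:
  fixes y :: "nat \<Rightarrow> 'a"
  assumes rec: "uniformly_recurrent y"
  shows "\<exists>R0. \<forall>x. factors x = factors y \<longrightarrow> (\<forall>q\<in>Q. \<exists>V. \<forall>t\<ge>R0. \<forall>R\<ge>R0. window \<delta> q x t R = V)"
proof -
  obtain w u where wu: "w @ u \<in> factors y"
    and im: "\<And>v. v @ w \<in> factors y \<Longrightarrow> (\<lambda>q. foldl \<delta> q (v @ w)) ` Q = (\<lambda>q. foldl \<delta> q w) ` Q"
    and max: "\<And>p v. p \<in> (\<lambda>q. foldl \<delta> q w) ` Q \<Longrightarrow> w @ u @ v \<in> factors y \<Longrightarrow>
           visits \<delta> (u @ v) p = visits \<delta> u p"
    using saturating_word[of y] by blast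
  define B where "B = (\<lambda>q. foldl \<delta> q w) ` Q"
  have finB: "finite B" using Q by (simp add: B_def)
  obtain R where R: "\<And>v. v \<in> factors y \<Longrightarrow> length v = R \<Longrightarrow> \<exists>a b. v = a @ (w @ u) @ b"
    using rec wu unfolding uniformly_recurrent_def by metis
  let ?V = "visits \<delta> u"
  \<comment> \<open>Any \<open>R\<close> consecutive letters contain \<open>w @ u\<close>; the successor makes room for the state reached
    after its last letter.\<close>
  have "\<exists>V. \<forall>t\<ge>Suc R. \<forall>R'\<ge>Suc R. window \<delta> q x t R' = V" if x: "factors x = factors y" and q: "q \<in> Q" for x q
  proof -
    have occ: "\<exists>s\<ge>t. s + length (w @ u) \<le> t + R \<and> occurs_at (w @ u) x s" for t
    proof -
      obtain a b where ab: "map x [t..<t + R] = a @ (w @ u) @ b"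
        using R[of "map x [t..<t + R]"] factorsI[of x t R] x by auto
      have len: "R = length a + length (w @ u) + length b"
        using arg_cong[OF ab, of length] by simp
      have "w @ u = take (length (w @ u)) (drop (length a) (map x [t..<t + R]))" by (simp add: ab)
      also have "\<dots> = map x [t + length a..<t + length a + length (w @ u)]"
        using len by (simp add: drop_map take_map)
      finally show ?thesis
        using len unfolding occurs_at_def by (intro exI[of _ "t + length a"]) auto
    qed
    let ?run = "\<lambda>s p k. foldl \<delta> p (map x [s + length w..<k])"
    \<comment> \<open>By maximality of \<open>u\<close>, whatever follows an occurrence of \<open>w @ u\<close>, only the states visited
      while reading \<open>u\<close> are ever visited again.\<close>
    have future: "?run s p ` {s + length w..} = ?V p"
        and soon: "?V p \<subseteq> ?run s p ` {s + length w..s + length (w @ u)}"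
      if s: "occurs_at (w @ u) x s" and p: "p \<in> B" for s p
    proof -
      have fac: "map x [s..<k] \<in> factors y" if "k \<ge> s" for k
        using factorsI'[OF that, of x] x by simp
      have xw: "map x [s..<s + length w] = w" and xu: "map x [s + length w..<s + length (w @ u)] = u"
        using s unfolding occurs_at_append by (simp_all add: occurs_at_def add.assoc)
      show soon: "?V p \<subseteq> ?run s p ` {s + length w..s + length (w @ u)}"
      proof
        fix r assume "r \<in> ?V p"
        then obtain k where k: "k \<le> length u" "r = foldl \<delta> p (take k u)" by (auto simp: visits_def)
        have "take k u = map x [s + length w..<s + length w + k]"
          using k(1) by (subst xu[symmetric]) (simp add: take_map)
        thus "r \<in> ?run s p ` {s + length w..s + length (w @ u)}"
          using k by (intro image_eqI[of _ _ "s + length w + k"]) auto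
      qed
      have "?run s p k \<in> ?V p" if k: "k \<ge> s + length w" for k
      proof (cases "k \<le> s + length (w @ u)")
        case True
        have "map x [s + length w..<k] = take (k - (s + length w)) u"
          using k True by (subst xu[symmetric]) (simp add: take_map)
        thus ?thesis unfolding visits_def using k True
          by (intro image_eqI[of _ _ "k - (s + length w)"]) auto
      next
        case False
        define v where "v = map x [s + length (w @ u)..<k]"
        have "[s + length w..<k] = [s + length w..<s + length (w @ u)] @ [s + length (w @ u)..<k]"
          using False by (intro upt_append[symmetric]) auto
        hence 1: "map x [s + length w..<k] = u @ v" using xu by (simp add: v_def)
        have "[s..<k] = [s..<s + length w] @ [s + length w..<k]"
          using k by (intro upt_append[symmetric]) auto
        hence "map x [s..<k] = w @ u @ v" using xw 1 by simp
        hence "visits \<delta> (u @ v) p = ?V p" using fac[of k] k p by (intro max) (auto simp: B_def)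
        thus ?thesis using foldl_in_visits[of \<delta> p "u @ v"] by (simp add: 1)
      qed
      with soon show "?run s p ` {s + length w..} = ?V p" by (auto intro!: antisym)
    qed
    \<comment> \<open>Between two occurrences the set of future states can only shrink, for each of the states in \<open>B\<close>.
      Since the run permutes \<open>B\<close>, the sum of the sizes is unchanged, and so no set shrinks.\<close>
    have const: "?V (?run s p (s' + length w)) = ?V p"
      if s: "occurs_at (w @ u) x s" "occurs_at (w @ u) x s'" and ss: "s \<le> s'" and p: "p \<in> B" for s s' p
    proof -
      let ?\<pi> = "\<lambda>p. ?run s p (s' + length w)"
      have xw: "map x [r..<r + length w] = w" if "occurs_at (w @ u) x r" for r
        using that unfolding occurs_at_append by (simp add: occurs_at_def)
      have "map x [s..<s' + length w] = map x [s..<s'] @ w"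
        using ss xw[OF s(2)] upt_add_eq_append[of s s' "length w"] by simp
      hence v: "map x [s..<s'] @ w \<in> factors y"
        using factorsI'[of s "s' + length w" x] ss x by simp
      have "?\<pi> ` B = B"
      proof -
        have "[s..<s' + length w] = [s..<s + length w] @ [s + length w..<s' + length w]"
          using ss by (intro upt_append[symmetric]) auto
        hence "map x [s..<s'] @ w = w @ map x [s + length w..<s' + length w]"
          using \<open>map x [s..<s' + length w] = map x [s..<s'] @ w\<close> xw[OF s(1)] by simp
        hence "?\<pi> ` B = (\<lambda>q. foldl \<delta> q (map x [s..<s'] @ w)) ` Q"
          by (simp only: B_def image_image foldl_append)
        thus ?thesis using im[OF v] by (simp add: B_def)
      qed
      hence inj: "inj_on ?\<pi> B" using finB by (intro eq_card_imp_inj_on) simp_all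
      have sub: "?V (?\<pi> p) \<subseteq> ?V p" if p: "p \<in> B" for p
      proof -
        have \<pi>p: "?\<pi> p \<in> B" using \<open>?\<pi> ` B = B\<close> p by blast
        have "?run s' (?\<pi> p) k = ?run s p k" if "k \<ge> s' + length w" for k
        proof -
          have "[s + length w..<k] = [s + length w..<s' + length w] @ [s' + length w..<k]"
            using ss that by (intro upt_append[symmetric]) auto
          thus ?thesis by simp
        qed
        hence "?run s' (?\<pi> p) ` {s' + length w..} \<subseteq> ?run s p ` {s + length w..}"
          using ss by (intro image_subsetI) auto
        thus ?thesis using future[OF s(2) \<pi>p] future[OF s(1) p] by simp
      qed
      show ?thesis
      proof (rule ccontr)
        assume "?V (?\<pi> p) \<noteq> ?V p"
        hence "card (?V (?\<pi> p)) < card (?V p)"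
          using sub[OF p] by (intro psubset_card_mono finite_visits) auto
        hence "(\<Sum>p\<in>B. card (?V (?\<pi> p))) < (\<Sum>p\<in>B. card (?V p))"
          using finB p by (intro sum_strict_mono_ex1 ballI bexI[of _ p] card_mono finite_visits sub)
        moreover have "(\<Sum>p\<in>B. card (?V (?\<pi> p))) = (\<Sum>p\<in>B. card (?V p))"
          using sum.reindex[OF inj, of "\<lambda>p. card (?V p)"] \<open>?\<pi> ` B = B\<close> by (simp add: comp_def)
        ultimately show False by simp
      qed
    qed
    obtain s0 where s0: "s0 + length (w @ u) \<le> R" "occurs_at (w @ u) x s0"
      using occ[of 0] by auto
    define p0 where "p0 = run \<delta> q x (s0 + length w)"
    have p0: "p0 \<in> B"
    proof -
      have "map x [s0..<s0 + length w] = w"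
        using s0(2) unfolding occurs_at_append by (simp add: occurs_at_def)
      hence "p0 = foldl \<delta> (run \<delta> q x s0) w" unfolding p0_def by (subst run_later[of s0]) simp_all
      thus ?thesis using run_in[OF q] by (simp add: B_def)
    qed
    have run: "run \<delta> q x k = ?run s0 p0 k" if "k \<ge> s0 + length w" for k
      unfolding p0_def using run_later[OF that] .
    have "window \<delta> q x t R' = ?V p0" if t: "t \<ge> Suc R" "R' \<ge> Suc R" for t R'
    proof
      have "window \<delta> q x t R' \<subseteq> ?run s0 p0 ` {s0 + length w..}"
        unfolding window_def using s0(1) t run by (intro image_subsetI) auto
      thus "window \<delta> q x t R' \<subseteq> ?V p0" using future[OF s0(2) p0] by simp
    next
      obtain s where s: "s \<ge> t" "s + length (w @ u) \<le> t + R" "occurs_at (w @ u) x s"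
        using occ[of t] by blast
      define p where "p = run \<delta> q x (s + length w)"
      have ss: "s0 \<le> s" using s0(1) s(1) t by simp
      have p_eq: "p = ?run s0 p0 (s + length w)" unfolding p_def using ss by (intro run) simp
      have "p \<in> B"
      proof -
        have "map x [s..<s + length w] = w"
          using s(3) unfolding occurs_at_append by (simp add: occurs_at_def)
        hence "p = foldl \<delta> (run \<delta> q x s) w" unfolding p_def by (subst run_later[of s]) simp_all
        thus ?thesis using run_in[OF q] by (simp add: B_def)
      qed
      have "?V p0 = ?V p" using const[OF s0(2) s(3) ss p0] by (simp add: p_eq)
      also have "\<dots> \<subseteq> ?run s p ` {s + length w..s + length (w @ u)}"
        by (rule soon[OF s(3) \<open>p \<in> B\<close>])
      also have "\<dots> \<subseteq> window \<delta> q x t R'"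
      proof (intro image_subsetI)
        fix k assume k: "k \<in> {s + length w..s + length (w @ u)}"
        hence "?run s p k = run \<delta> q x k" unfolding p_def by (intro run_later[symmetric]) simp
        thus "?run s p k \<in> window \<delta> q x t R'"
          using k s(1,2) t unfolding window_def by (intro image_eqI[of _ _ k]) auto
      qed
      finally show "?V p0 \<subseteq> window \<delta> q x t R'" .
    qed
    thus ?thesis by blast
  qed
  thus ?thesis by blast
qed

end

section \<open>Runs on quasiminimal subshifts\<close>

text \<open>
  After \<open>N\<close> steps every point is uniformly recurrent with one of finitely many sets of factors;
  the largest of the corresponding bounds works for all of them.
\<close>

lemma windows_stabilize:
  fixes \<delta> :: "'q \<Rightarrow> 'a \<Rightarrow> 'q"
  assumes "finite S" "subshift S X" "quasiminimal S X"
    and "finite Q" "\<And>q a. q \<in> Q \<Longrightarrow> \<delta> q a \<in> Q"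
  shows "\<exists>R>0. \<forall>x\<in>X. \<forall>q\<in>Q. window \<delta> q x R R = window \<delta> q x (Suc R) R"
proof -
  have fin: "finite (factors ` X)" using assms(2,3) by (rule quasiminimal_finite_factors)
  define N where "N = card (factors ` X)"
  define stable where "stable = (\<lambda>L R0. \<forall>x. factors x = L \<longrightarrow>
      (\<forall>q\<in>Q. \<exists>V. \<forall>t\<ge>R0. \<forall>R\<ge>R0. window \<delta> q x t R = V))"
  have ex: "\<exists>R0. stable (factors (drop_seq N x)) R0" if "x \<in> X" for x
    unfolding stable_def N_def
    by (rule windows_stabilize_uniformly_recurrent[OF assms(4,5)
        uniformly_recurrent_tail[OF assms(1,2) fin that]])
  define f where "f = (\<lambda>L. SOME R0. stable L R0)"
  have f: "stable (factors (drop_seq N x)) (f (factors (drop_seq N x)))" if "x \<in> X" for x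
    unfolding f_def by (rule someI_ex[OF ex[OF that]])
  define M where "M = Max (insert 0 (f ` factors ` X))"
  have M: "f (factors x) \<le> M" if "x \<in> X" for x
    unfolding M_def using fin that by (intro Max_ge) auto
  define R where "R = Suc (N + M)"
  have "window \<delta> q x R R = window \<delta> q x (Suc R) R" if x: "x \<in> X" and q: "q \<in> Q" for x q
  proof -
    have "run \<delta> q x N \<in> Q" using assms(5) q by (induction N) simp_all
    hence "\<exists>V. \<forall>t\<ge>f (factors (drop_seq N x)). \<forall>R\<ge>f (factors (drop_seq N x)).
        window \<delta> (run \<delta> q x N) (drop_seq N x) t R = V"
      using f[OF x, unfolded stable_def, THEN spec[of _ "drop_seq N x"]] by simp
    then obtain V where V: "\<And>t R. t \<ge> f (factors (drop_seq N x)) \<Longrightarrow>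
        R \<ge> f (factors (drop_seq N x)) \<Longrightarrow> window \<delta> (run \<delta> q x N) (drop_seq N x) t R = V"
      by (elim exE) simp
    have "window \<delta> q x (N + t) R = V" if "t \<ge> M" for t
      unfolding window_drop_seq using M[OF drop_seq_in_subshift[OF assms(2) x], of N] that
      by (intro V) (simp_all add: R_def)
    from this[of "Suc M"] this[of "Suc (Suc M)"] show ?thesis by (simp add: R_def)
  qed
  moreover have "R > 0" by (simp add: R_def)
  ultimately show ?thesis by (intro exI[of _ R] conjI ballI)
qed

text \<open>
  The two windows are compared at time \<open>R\<close> only, but for all points and all states; applied to
  the shifts of a point, this makes all later windows equal.
\<close>

lemma infinitely_visited_eq_window:
  assumes X: "subshift S X" and Q: "\<And>q a. q \<in> Q \<Longrightarrow> \<delta> q a \<in> Q"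
    and R: "R > 0" "\<And>x q. x \<in> X \<Longrightarrow> q \<in> Q \<Longrightarrow> window \<delta> q x R R = window \<delta> q x (Suc R) R"
    and x: "x \<in> X" and q: "q \<in> Q"
  shows "{p. infinite {n. run \<delta> q x n = p}} = window \<delta> q x R R"
proof -
  have run: "run \<delta> q x j \<in> Q" for j using Q q by (induction j) simp_all
  have win: "window \<delta> q x (j + R) R = window \<delta> q x R R" for j
  proof (induction j)
    case (Suc j)
    have "window \<delta> q x (Suc j + R) R = window \<delta> q x (j + Suc R) R" by simp
    also have "\<dots> = window \<delta> q x (j + R) R"
      unfolding window_drop_seq using R(2)[OF drop_seq_in_subshift[OF X x] run] by simp
    finally show ?case using Suc by simp
  qed simp
  have in_win: "run \<delta> q x n \<in> window \<delta> q x R R" if "n \<ge> R" for n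
  proof -
    have "run \<delta> q x n \<in> window \<delta> q x n R" using R(1) by (simp add: window_def)
    thus ?thesis using win[of "n - R"] that by simp
  qed
  show ?thesis
  proof (intro set_eqI iffI)
    fix p assume "p \<in> {p. infinite {n. run \<delta> q x n = p}}"
    then obtain n where "n \<ge> R" "run \<delta> q x n = p" unfolding infinite_nat_iff_unbounded_le by auto
    thus "p \<in> window \<delta> q x R R" using in_win by blast
  next
    fix p assume p: "p \<in> window \<delta> q x R R"
    have "\<exists>n\<ge>m. run \<delta> q x n = p" for m
    proof -
      have "p \<in> window \<delta> q x (m + R) R" using p win by simp
      then obtain n where "n \<ge> m + R" "p = run \<delta> q x n" by (auto simp: window_def)
      thus ?thesis by (intro exI[of _ n]) simp
    qed
    thus "p \<in> {p. infinite {n. run \<delta> q x n = p}}" unfolding infinite_nat_iff_unbounded_le by simp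
  qed
qed

section \<open>The decision procedure\<close>

text \<open>
  Truncating the entries makes every number \<open>c\<close> describe an automaton with states \<open>{..code_nth c 0}\<close>,
  so that the search for a window length ends on all inputs. For the code of a Muller automaton no entry is
  changed; its states are the numbers strictly below \<open>code_nth c 0\<close>, and the additional
  state is never reached from them.
\<close>

definition table_step :: "nat \<Rightarrow> nat \<Rightarrow> nat \<Rightarrow> nat" where
  "table_step c q j = min (code_nth (code_nth (code_nth c 2) q) j) (code_nth c 0)"

lemma table_step_in: "table_step c q j \<in> {..code_nth c 0}"
  by (simp add: table_step_def)

lemma computable_run [computable_intros]:
  assumes "computable a" "computable b" "computable c" "computable d"
  shows "computable (\<lambda>e. run (table_step (a e)) (b e) (digit s (c e)) (d e))"
proof -
  have "rec_nat q (\<lambda>k r. \<delta> r (x k)) t = run \<delta> q x t"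
    for \<delta> :: "nat \<Rightarrow> nat \<Rightarrow> nat" and q x t
    by (induction t) simp_all
  moreover have "computable (\<lambda>e. rec_nat (e 1) (\<lambda>k r. table_step (e 0) r (digit s (e 2) k)) (e 3))"
    unfolding table_step_def by (intro computable_intros)
  ultimately have run: "computable (\<lambda>e. run (table_step (e 0)) (e 1) (digit s (e 2)) (e 3))"
    by (simp only:)
  have "computable (\<lambda>e. if i = 0 then a e else if i = 1 then b e else if i = 2 then c e else d e)"
    for i :: nat
    using assms by (cases "i = 0"; cases "i = 1"; cases "i = 2") simp_all
  from computable_subst[where s = "\<lambda>e i. if i = 0 then a e else if i = 1 then b e else
      if i = 2 then c e else d e", OF run this]
  show ?thesis by simp
qed

text \<open>
  The condition \<open>window q x R R = window q x (Suc R) R\<close>, expressed on the words of length \<open>2 R + 1\<close> in the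
  language.
\<close>

definition certified :: "(nat \<Rightarrow> bool) \<Rightarrow> nat \<Rightarrow> nat \<Rightarrow> nat \<Rightarrow> bool" where
  "certified lang s c R \<longleftrightarrow>
     (\<forall>d<s ^ Suc (R + R). lang (digits_code s d (Suc (R + R))) \<longrightarrow>
       (\<forall>q\<le>code_nth c 0. \<forall>p\<le>code_nth c 0.
         (\<exists>k<R. run (table_step c) q (digit s d) (R + k) = p) \<longleftrightarrow>
         (\<exists>k<R. run (table_step c) q (digit s d) (Suc R + k) = p)))"

text \<open>
  A set in the acceptance family has a code \<open>v\<close> in \<open>set_decode (code_nth c 3)\<close>, and it is compared
  with the window \<open>R\<close>, ..., \<open>2 R - 1\<close> of the run. The bound on \<open>v\<close> holds since
  \<open>v < 2 ^ v\<close>.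
\<close>

definition accepting :: "(nat \<Rightarrow> bool) \<Rightarrow> nat \<Rightarrow> nat \<Rightarrow> nat \<Rightarrow> bool" where
  "accepting lang s c R \<longleftrightarrow>
     (\<exists>d<s ^ (R + R). lang (digits_code s d (R + R)) \<and>
       (\<exists>v\<le>code_nth c 3. v \<in> set_decode (code_nth c 3) \<and>
         (\<forall>p\<le>code_nth c 0. p \<in> set_decode v \<longleftrightarrow>
           (\<exists>k<R. run (table_step c) (min (code_nth c 1) (code_nth c 0)) (digit s d) (R + k) = p))))"

text \<open>
  Minimisation applies to functions with a zero for every argument; the assumption \<open>ex\<close>, for all numbers
  \<open>c\<close> and not only for codes of automata, provides it.
\<close>

lemma computable_search:
  assumes lang: "computable_pred (\<lambda>e. lang (e 0))" and ex: "\<And>c. \<exists>R. 0 < R \<and> certified lang s c R"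
  shows "computable_pred (\<lambda>e. accepting lang s (e 0) (LEAST R. 0 < R \<and> certified lang s (e 0) R))"
proof -
  have "computable_pred (\<lambda>e. 0 < e 0 \<and> certified lang s (e (Suc 0)) (e 0))"
    unfolding certified_def by (intro computable_intros computable_pred_comp1[OF lang])
  hence least: "computable (\<lambda>e. LEAST R. 0 < R \<and> certified lang s (e 0) R)"
    by (rule computable_Least) (rule ex)
  have "computable_pred (\<lambda>e. accepting lang s (e 0) (e 1))"
    unfolding accepting_def by (intro computable_intros computable_pred_comp1[OF lang])
  hence "computable (\<lambda>e. of_bool (accepting lang s (e 0) (e 1)))" by (rule computable_of_bool)
  from computable_comp2[OF this computable_var least] show ?thesis
    unfolding computable_pred_def .
qed

text \<open>
  This links the algorithm to \<open>X\<close>: the numbers below \<open>s ^ n\<close> range over all words of length \<open>n\<close>, and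
  \<open>lang\<close> selects those in the language, which are the prefixes of points of \<open>X\<close>.
\<close>

lemma ex_digits_iff_ex_point:
  assumes S: "finite S" and X: "subshift S X"
    and lang: "\<And>w. w \<in> lists S \<Longrightarrow> lang (word_code S w) \<longleftrightarrow> w \<in> language X"
    and P: "\<And>g h. (\<And>i. i < n \<Longrightarrow> g i = h i) \<Longrightarrow> P g \<longleftrightarrow> P h"
    and s: "s = card S" "s > 0"
  shows "(\<exists>d<s ^ n. lang (digits_code s d n) \<and> P (digit s d)) \<longleftrightarrow> (\<exists>x\<in>X. P (to_nat_on S \<circ> x))"
proof
  assume "\<exists>d<s ^ n. lang (digits_code s d n) \<and> P (digit s d)"
  then obtain d where d: "lang (digits_code s d n)" "P (digit s d)" by blast
  have dig: "digit s d i < card S" for i using s by (simp add: digit_def)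
  define w where "w = map (from_nat_into S \<circ> digit s d) [0..<n]"
  have "S \<noteq> {}" using s by auto
  hence "w \<in> lists S" by (auto simp: w_def from_nat_into[OF \<open>S \<noteq> {}\<close>])
  moreover have inv: "to_nat_on S (from_nat_into S (digit s d i)) = digit s d i" for i
    using dig S by (intro to_nat_on_from_nat_into) (simp add: to_nat_on_finite[THEN bij_betw_imp_surj_on])
  hence "word_code S w = digits_code s d n"
    by (simp add: word_code_def w_def digits_code_eq comp_def)
  ultimately have "w \<in> language X" using lang d(1) by metis
  then obtain x where x: "x \<in> X" "w = map x [0..<length w]"
    unfolding language_prefixes[OF X] by blast
  have "(to_nat_on S \<circ> x) i = digit s d i" if "i < n" for i
  proof -
    have "x i = w ! i" using that by (subst x(2)) (simp add: w_def)
    thus ?thesis using that inv by (simp add: w_def)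
  qed
  hence "P (to_nat_on S \<circ> x)" using d(2) P by blast
  thus "\<exists>x\<in>X. P (to_nat_on S \<circ> x)" using x(1) by blast
next
  assume "\<exists>x\<in>X. P (to_nat_on S \<circ> x)"
  then obtain x where x: "x \<in> X" "P (to_nat_on S \<circ> x)" by blast
  have xS: "x i \<in> S" for i using subshift_letter[OF X x(1)] .
  have "to_nat_on S (x i) < s" for i
    using to_nat_on_finite[OF S] xS[of i] s(1) by (auto simp: bij_betw_def)
  then obtain d where d: "d < s ^ n" "\<forall>i<n. digit s d i = to_nat_on S (x i)"
    using digits_exist[of n "\<lambda>i. to_nat_on S (x i)" s] by blast
  have "digits_code s d n = word_code S (map x [0..<n])"
  proof -
    have "map (digit s d) [0..<n] = map (to_nat_on S) (map x [0..<n])" using d(2) by simp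
    thus ?thesis unfolding digits_code_eq word_code_def by (simp only:)
  qed
  moreover have "map x [0..<n] \<in> lists S" using xS by auto
  moreover have "map x [0..<n] \<in> language X"
    unfolding language_prefixes[OF X] using x(1) by (intro bexI[of _ x]) simp_all
  ultimately have "lang (digits_code s d n)" using lang by simp
  moreover have "P (digit s d)" using x(2) d(2) P[of "digit s d" "to_nat_on S \<circ> x"] by simp
  ultimately show "\<exists>d<s ^ n. lang (digits_code s d n) \<and> P (digit s d)" using d(1) by blast
qed

lemma window_table_step_subset:
  "q \<le> code_nth c 0 \<Longrightarrow> window (table_step c) q x t R \<subseteq> {..code_nth c 0}"
proof -
  assume "q \<le> code_nth c 0"
  hence "run (table_step c) q x k \<le> code_nth c 0" for k
    using table_step_in by (cases k) auto
  thus ?thesis by (auto simp: window_def)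
qed

theorem theorem1:
  fixes S :: "'a set" and X :: "(nat \<Rightarrow> 'a) set"
  assumes "finite S"
    and "subshift S X"
    and "recursive_subshift S X"
    and "quasiminimal S X"
  shows "decidable_subshift S X"
proof (cases "S = {}")
  case True
  hence "X = {}" using subshift_letter[OF assms(2)] by blast
  have "computable_pred (\<lambda>e. e 0 < (0::nat))" by (intro computable_intros)
  thus ?thesis unfolding decidable_subshift_def \<open>X = {}\<close>
    by (rule decidable_problemI) simp
next
  case False
  define s where "s = card S"
  have s: "s > 0" using False assms(1) by (simp add: s_def card_gt_0_iff)
  obtain f where f: "recursive_fun 1 f"
    "\<And>w. w \<in> lists S \<Longrightarrow> f [word_code S w] = (if w \<in> language X then 1 else 0)"
    using assms(3) unfolding recursive_subshift_def decidable_problem_def by blast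
  define lang where "lang = (\<lambda>n. f [n] = 1)"
  have "computable_pred (\<lambda>e. lang (e 0))"
    unfolding lang_def by (intro computable_intros computable_recursive_fun[OF f(1)])
  have lang: "lang (word_code S w) \<longleftrightarrow> w \<in> language X" if "w \<in> lists S" for w
    using f(2)[OF that] by (simp add: lang_def)
  note ex_iff = ex_digits_iff_ex_point[OF assms(1,2) lang _ s_def s]
  define step where "step = (\<lambda>c q a. table_step c q (to_nat_on S a))"
  have certified_iff: "certified lang s c R \<longleftrightarrow> (\<forall>x\<in>X. \<forall>q\<in>{..code_nth c 0}.
      window (step c) q x R R = window (step c) q x (Suc R) R)" for c R
  proof -
    define P where "P = (\<lambda>g. \<forall>q\<in>{..code_nth c 0}.
        window (table_step c) q g R R = window (table_step c) q g (Suc R) R)"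
    have P: "(\<forall>q\<le>code_nth c 0. \<forall>p\<le>code_nth c 0.
         (\<exists>k<R. run (table_step c) q g (R + k) = p) \<longleftrightarrow>
         (\<exists>k<R. run (table_step c) q g (Suc R + k) = p)) \<longleftrightarrow> P g" for g
    proof -
      have "(\<forall>p\<le>m. p \<in> A \<longleftrightarrow> p \<in> B) \<longleftrightarrow> A = B" if "A \<subseteq> {..m}" "B \<subseteq> {..m}"
        for m :: nat and A B
        using that by blast
      thus ?thesis unfolding P_def ex_run_iff_window
        using window_table_step_subset[of _ c g] by (simp add: Ball_def)
    qed
    have digits: "(\<exists>d<s ^ Suc (R + R). lang (digits_code s d (Suc (R + R))) \<and> \<not> P (digit s d))
        \<longleftrightarrow> (\<exists>x\<in>X. \<not> P (to_nat_on S \<circ> x))"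
    proof (rule ex_iff)
      fix g h :: "nat \<Rightarrow> nat" assume "\<And>i. i < Suc (R + R) \<Longrightarrow> g i = h i"
      hence "window (table_step c) q g t R = window (table_step c) q h t R" if "t \<le> Suc R" for q t
        using that by (intro window_cong) simp
      thus "(\<not> P g) = (\<not> P h)" by (simp add: P_def)
    qed
    have "certified lang s c R \<longleftrightarrow>
        \<not> (\<exists>d<s ^ Suc (R + R). lang (digits_code s d (Suc (R + R))) \<and> \<not> P (digit s d))"
      unfolding certified_def P by blast
    thus ?thesis unfolding digits by (simp add: P_def step_def window_comp)
  qed
  have step_in: "step c q a \<in> {..code_nth c 0}" for c q a
    unfolding step_def by (rule table_step_in)
  have ex: "\<exists>R. 0 < R \<and> certified lang s c R" for c
    unfolding certified_iff
    using windows_stabilize[OF assms(1,2,4), of "{..code_nth c 0}" "step c"] step_in by blast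
  define radius where "radius = (\<lambda>c. LEAST R. 0 < R \<and> certified lang s c R)"
  have radius: "radius c > 0" "certified lang s c (radius c)" for c
    using LeastI_ex[OF ex[of c]] by (simp_all add: radius_def)
  have "computable_pred (\<lambda>e. accepting lang s (e 0) (radius (e 0)))"
    unfolding radius_def using computable_search[OF \<open>computable_pred (\<lambda>e. lang (e 0))\<close> ex] .
  moreover have "accepting lang s (muller_code S A) (radius (muller_code S A)) \<longleftrightarrow>
      A \<in> {A. X \<inter> muller_language S A \<noteq> {}}" if A: "A \<in> {A. muller_automaton S A}" for A
  proof -
    define c where "c = muller_code S A"
    define R where "R = radius c"
    have valid: "initial A < num_states A" "\<And>q a. q < num_states A \<Longrightarrow> a \<in> S \<Longrightarrow> trans_fun A q a < num_states A"
      "acc_family A \<subseteq> Pow {..<num_states A}"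
      using A by (auto simp: muller_automaton_def)
    have c: "code_nth c 0 = num_states A" "code_nth c 1 = initial A"
      "code_nth c 3 = set_encode (set_encode ` acc_family A)"
      by (simp_all add: c_def muller_code_def code_nth_list_encode del: list_encode.simps)
    have c2: "code_nth (code_nth (code_nth c 2) q) j = trans_fun A q (from_nat_into S j)"
      if "q < num_states A" "j < card S" for q j
      using that by (simp add: c_def muller_code_def code_nth_list_encode del: list_encode.simps)
    have step: "step c q a = trans_fun A q a" if "q < num_states A" "a \<in> S" for q a
    proof -
      have "to_nat_on S a < card S"
        using to_nat_on_finite[OF assms(1)] that(2) by (auto simp: bij_betw_def)
      moreover have "from_nat_into S (to_nat_on S a) = a"
        using assms(1) that(2) by (intro from_nat_into_to_nat_on countable_finite)
      ultimately show ?thesis using c2 c(1) valid(2)[OF that] that(1)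
        by (simp add: step_def table_step_def)
    qed
    have run: "run (step c) (initial A) x t = muller_run A x t \<and> muller_run A x t < num_states A"
      if "x \<in> X" for x t
    proof (induction t)
      case (Suc t)
      have "x t \<in> S" using subshift_letter[OF assms(2) that] .
      thus ?case using Suc step valid(2) by simp
    qed (simp add: valid)
    have inf: "{q. infinite {n. muller_run A x n = q}} = window (step c) (initial A) x R R"
      if x: "x \<in> X" for x
    proof -
      have "{q. infinite {n. run (step c) (initial A) x n = q}} = window (step c) (initial A) x R R"
      proof (rule infinitely_visited_eq_window[OF assms(2)])
        show "R > 0" by (simp add: R_def radius)
        fix x q assume "x \<in> X" "q \<in> {..num_states A}"
        thus "window (step c) q x R R = window (step c) q x (Suc R) R"
          using radius(2)[of c] unfolding certified_iff by (simp add: R_def c)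
      qed (use step_in[of c] x valid(1) c(1) in auto)
      thus ?thesis using run[OF x] by simp
    qed
    have fin_fam: "finite (acc_family A)" using valid(3) by (rule finite_subset) simp
    have fin: "finite F" if "F \<in> acc_family A" for F
      using valid(3) that by (auto intro: finite_subset)
    define P where "P = (\<lambda>g. window (table_step c) (initial A) g R R \<in> acc_family A)"
    have P: "(\<exists>v\<le>code_nth c 3. v \<in> set_decode (code_nth c 3) \<and>
         (\<forall>p\<le>code_nth c 0. p \<in> set_decode v \<longleftrightarrow>
           (\<exists>k<R. run (table_step c) (min (code_nth c 1) (code_nth c 0)) g (R + k) = p))) \<longleftrightarrow> P g" for g
    proof -
      let ?W = "window (table_step c) (initial A) g R R"
      have W: "?W \<subseteq> {..num_states A}"
        using window_table_step_subset[of "initial A" c g R R] valid(1) by (simp add: c)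
      have dec: "set_decode (code_nth c 3) = set_encode ` acc_family A"
        unfolding c by (rule set_encode_inverse) (use fin_fam in simp)
      have le: "v \<le> code_nth c 3" if "v \<in> set_decode (code_nth c 3)" for v
      proof -
        have "v < 2 ^ v" by simp
        also have "2 ^ v \<le> code_nth c 3"
          using that by (cases "code_nth c 3 < 2 ^ v") (simp_all add: set_decode_def)
        finally show ?thesis by simp
      qed
      have min: "min (code_nth c 1) (code_nth c 0) = initial A"
        unfolding c using valid(1) by simp
      have "(\<exists>v\<le>code_nth c 3. v \<in> set_decode (code_nth c 3) \<and>
         (\<forall>p\<le>code_nth c 0. p \<in> set_decode v \<longleftrightarrow> p \<in> ?W)) \<longleftrightarrow>
         (\<exists>v\<in>set_decode (code_nth c 3). \<forall>p\<le>num_states A. p \<in> set_decode v \<longleftrightarrow> p \<in> ?W)"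
        using le unfolding c(1) by (intro iffI; elim exE conjE bexE; blast)
      also have "\<dots> \<longleftrightarrow> (\<exists>F\<in>acc_family A. \<forall>p\<le>num_states A. p \<in> F \<longleftrightarrow> p \<in> ?W)"
        unfolding dec using fin by (simp add: set_encode_inverse)
      also have "\<dots> \<longleftrightarrow> (\<exists>F\<in>acc_family A. F = ?W)"
      proof (intro bex_cong refl)
        fix F assume "F \<in> acc_family A"
        hence "F \<subseteq> {..<num_states A}" using valid(3) by blast
        also have "\<dots> \<subseteq> {..num_states A}" by auto
        finally have "F \<subseteq> {..num_states A}" .
        thus "(\<forall>p\<le>num_states A. p \<in> F \<longleftrightarrow> p \<in> ?W) \<longleftrightarrow> F = ?W" using W by blast
      qed
      finally show ?thesis unfolding P_def ex_run_iff_window min by simp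
    qed
    have "accepting lang s c R \<longleftrightarrow> (\<exists>d<s ^ (R + R). lang (digits_code s d (R + R)) \<and> P (digit s d))"
      unfolding accepting_def P ..
    also have "\<dots> \<longleftrightarrow> (\<exists>x\<in>X. P (to_nat_on S \<circ> x))"
    proof (rule ex_iff)
      fix g h :: "nat \<Rightarrow> nat" assume "\<And>i. i < R + R \<Longrightarrow> g i = h i"
      hence "window (table_step c) q g R R = window (table_step c) q h R R" for q
        by (intro window_cong) simp
      thus "P g = P h" by (simp add: P_def)
    qed
    also have "\<dots> \<longleftrightarrow> (\<exists>x\<in>X. x \<in> muller_language S A)"
    proof (intro bex_cong refl)
      fix x assume x: "x \<in> X"
      have "\<forall>i. x i \<in> S" using subshift_letter[OF assms(2) x] by blast
      thus "P (to_nat_on S \<circ> x) \<longleftrightarrow> x \<in> muller_language S A"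
        by (simp add: P_def muller_language_def inf[OF x] step_def window_comp)
    qed
    finally show ?thesis by (auto simp: R_def c_def)
  qed
  ultimately show ?thesis unfolding decidable_subshift_def by (intro decidable_problemI)
qed

end
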